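(* Let $(\lambda,\kappa)\in\mathbb{R}^+\times\mathbb{R}^+$ and consider the periodic initial boundary value problem for the generalized Hunter-Saxton system (see context). For initial data $(u_0,\rho_0)$ let $C(\alpha)=\lambda(\lambda u_0'(\alpha)^2-\kappa\rho_0(\alpha)^2)$, $\Omega=\{\alpha\in[0,1]: C(\alpha)=0\}$, $\Sigma=\{\alpha\in[0,1]: C(\alpha)\neq0\}$, and denote by $\overline\alpha$ the finite number of locations in $[0,1]$ where the largest of $$M=\max_{\alpha\in\Omega,\ \rho_0(\alpha)\neq0}\{2\lambda u_0'(\alpha)\},\qquad N=\max_{\alpha\in\Sigma,\ \rho_0(\alpha)\neq0}\{\lambda u_0'(\alpha)+\sqrt{\lambda\kappa}\,|\rho_0(\alpha)|\}$$ is attained. Then there exist smooth initial data (for which the earliest zero $\eta_*$ of $\mathcal{Q}$ is a single root) and a finite $t_*>0$ such that, as $t\uparrow t_*$, $u_x(\gamma(\overline\alpha,t),t)\to+\infty$, while $u_x(\gamma(\alpha,t),t)\to-\infty$ for $\alpha\ne\overline\alpha$. Moreover, if $\rho_0(\overline\alpha)>0$ or $\rho_0(\overline\alpha)<0$, $\rho(\gamma(\overline\alpha,t),t)$ diverges to $+\infty$ or respectively $-\infty$ as $t\uparrow t_*$, whereas, for $\alpha\neq\overline\alpha$ such that $\rho_0(\alpha)\neq0$, $\rho(\gamma(\alpha,t),t)$ vanishes as $t\uparrow t_*$ for $(\lambda,\kappa)\in(0,1]\times\mathbb{R}^+$, but converges to a non-trivial steady state when $(\lambda,\kappa)\in(1,+\infty)\times\mathbb{R}^+$.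 Lastly, if $\alpha\neq\overline\alpha$ but $\rho_0(\alpha)=0$, then $\rho(\gamma(\alpha,t),t)\equiv0$ for all time and $(\lambda,\kappa)\in\mathbb{R}^+\times\mathbb{R}^+$.
   Context: The initial boundary value problem is $$u_{xt}+uu_{xx}-\lambda u_x^2-\kappa\rho^2=I(t),\qquad \rho_t+u\rho_x=2\lambda\rho u_x,\qquad t>0,$$ $$I(t)=-\kappa\int_0^1\rho^2\,dx-(1+\lambda)\int_0^1u_x^2\,dx,$$ with $u(x,0)=u_0(x)$, $\rho(x,0)=\rho_0(x)$ for $x\in[0,1]$, and periodic boundary conditions $u(0,t)=u(1,t)$, $u_x(0,t)=u_x(1,t)$, $\rho(0,t)=\rho(1,t)$; $u$ is assumed to have mean zero, $\int_0^1u\,dx\equiv0$. Characteristics: $\dot\gamma(\alpha,t)=u(\gamma(\alpha,t),t)$, $\gamma(\alpha,0)=\alpha$. The solution along characteristics is understood through the representation formulas (for $\lambda\ne0$): with $\mathcal{Q}(\alpha,t)=C(\alpha)\eta(t)^2-2\lambda u_0'(\alpha)\eta(t)+1$, $\bar{\mathcal{P}}_0(t)=\int_0^1\mathcal{Q}(\alpha,t)^{-\frac1{2\lambda}}d\alpha$, and $\eta$ the strictly increasing solution of $\dot\eta=\bar{\mathcal{P}}_0^{-2\lambda}$, $\eta(0)=0$, $$u_x(\gamma(\alpha,t),t)=\frac{\bar{\mathcal{P}}_0^{-2\lambda}}{\lambda}\left\{\frac{\lambda u_0'(\alpha)-\eta C(\alpha)}{\mathcal{Q}(\alpha,t)}-\frac{1}{\bar{\mathcal{P}}_0}\int_0^1\frac{\lambda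 u_0'(\alpha)-\eta C(\alpha)}{\mathcal{Q}(\alpha,t)^{1+\frac1{2\lambda}}}d\alpha\right\},\qquad \rho(\gamma(\alpha,t),t)=\frac{\rho_0(\alpha)}{\mathcal{Q}(\alpha,t)}\bar{\mathcal{P}}_0^{-2\lambda}.$$ $\eta_*>0$ denotes the least positive value of $\eta$ at which $\mathcal{Q}$ vanishes for some $\alpha\in[0,1]$ (the zero is attained at the points $\overline\alpha$); it is a single root when, as a polynomial in $\eta$, $\mathcal{Q}$ at $\alpha=\overline\alpha$ has $\eta_*$ as a zero of multiplicity one. Here $\eta_*$ is the reciprocal of the larger of $M$ and $N$; the maximum $N$ may fail to exist since $\Sigma$ need not be closed, and in that case only $M$ is used. The time $t_*$ is $$t_*=\lim_{\eta\uparrow\eta_*}\int_0^\eta\left(\int_0^1\frac{d\alpha}{(C(\alpha)\sigma^2-2\lambda u_0'(\alpha)\sigma+1)^{\frac1{2\lambda}}}\right)^{2\lambda}d\sigma.$$ Standing assumptions: $\rho_0\not\equiv0$, $C(\alpha)\not\equiv0$, and $\Omega$ is a non-empty finite set. "$\alpha\ne\overline\alpha$" means $\alpha$ is not one of the points $\overline\alpha$. $\mathbb{R}^+=(0,\infty)$. *)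

theory Defs
  imports "HOL-Analysis.Analysis"
begin

subsection \<open>Initial data\<close>

text \<open>Functions on the circle are represented by 1-periodic functions on the whole real line, so
  that characteristics need not be reduced modulo 1.  Differentiability on the real line together
  with periodicity contains the boundary conditions at 0 and 1.\<close>

definition periodic1 :: "(real \<Rightarrow> real) \<Rightarrow> bool" where
  "periodic1 f \<longleftrightarrow> (\<forall>x. f (x + 1) = f x)"

definition smooth :: "(real \<Rightarrow> real) \<Rightarrow> bool" where
  "smooth f \<longleftrightarrow> (\<forall>n x. (deriv ^^ n) f field_differentiable (at x))"

definition Cfun :: "real \<Rightarrow> real \<Rightarrow> (real \<Rightarrow> real) \<Rightarrow> (real \<Rightarrow> real) \<Rightarrow> real \<Rightarrow> real" where
  "Cfun lam kap u0 rho0 \<alpha> = lam * (lam * (deriv u0 \<alpha>)\<^sup>2 - kap * (rho0 \<alpha>)\<^sup>2)"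

definition Omega :: "real \<Rightarrow> real \<Rightarrow> (real \<Rightarrow> real) \<Rightarrow> (real \<Rightarrow> real) \<Rightarrow> real set" where
  "Omega lam kap u0 rho0 = {\<alpha>\<in>{0..1}. Cfun lam kap u0 rho0 \<alpha> = 0}"

definition Sigma_set :: "real \<Rightarrow> real \<Rightarrow> (real \<Rightarrow> real) \<Rightarrow> (real \<Rightarrow> real) \<Rightarrow> real set" where
  "Sigma_set lam kap u0 rho0 = {\<alpha>\<in>{0..1}. Cfun lam kap u0 rho0 \<alpha> \<noteq> 0}"

definition admissible_data :: "real \<Rightarrow> real \<Rightarrow> (real \<Rightarrow> real) \<Rightarrow> (real \<Rightarrow> real) \<Rightarrow> bool" where
  "admissible_data lam kap u0 rho0 \<longleftrightarrow>
     smooth u0 \<and> smooth rho0 \<and> periodic1 u0 \<and> periodic1 rho0 \<and>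
     integral {0..1} u0 = 0 \<and>
     (\<exists>\<alpha>\<in>{0..1}. rho0 \<alpha> \<noteq> 0) \<and>
     (\<exists>\<alpha>\<in>{0..1}. Cfun lam kap u0 rho0 \<alpha> \<noteq> 0) \<and>
     Omega lam kap u0 rho0 \<noteq> {} \<and> finite (Omega lam kap u0 rho0)"

subsection \<open>The maxima M and N and the points where the larger one is attained\<close>

definition is_max :: "real set \<Rightarrow> real \<Rightarrow> bool" where
  "is_max S m \<longleftrightarrow> m \<in> S \<and> (\<forall>x\<in>S. x \<le> m)"

definition M_dom :: "real \<Rightarrow> real \<Rightarrow> (real \<Rightarrow> real) \<Rightarrow> (real \<Rightarrow> real) \<Rightarrow> real set" where
  "M_dom lam kap u0 rho0 = {\<alpha> \<in> Omega lam kap u0 rho0. rho0 \<alpha> \<noteq> 0}"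

definition N_dom :: "real \<Rightarrow> real \<Rightarrow> (real \<Rightarrow> real) \<Rightarrow> (real \<Rightarrow> real) \<Rightarrow> real set" where
  "N_dom lam kap u0 rho0 = {\<alpha> \<in> Sigma_set lam kap u0 rho0. rho0 \<alpha> \<noteq> 0}"

definition M_val :: "real \<Rightarrow> (real \<Rightarrow> real) \<Rightarrow> real \<Rightarrow> real" where
  "M_val lam u0 \<alpha> = 2 * lam * deriv u0 \<alpha>"

definition N_val :: "real \<Rightarrow> real \<Rightarrow> (real \<Rightarrow> real) \<Rightarrow> (real \<Rightarrow> real) \<Rightarrow> real \<Rightarrow> real" where
  "N_val lam kap u0 rho0 \<alpha> = lam * deriv u0 \<alpha> + sqrt (lam * kap) * \<bar>rho0 \<alpha>\<bar>"

definition is_M :: "real \<Rightarrow> real \<Rightarrow> (real \<Rightarrow> real) \<Rightarrow> (real \<Rightarrow> real) \<Rightarrow> real \<Rightarrow> bool" where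
  "is_M lam kap u0 rho0 m \<longleftrightarrow> is_max (M_val lam u0 ` M_dom lam kap u0 rho0) m"

definition is_N :: "real \<Rightarrow> real \<Rightarrow> (real \<Rightarrow> real) \<Rightarrow> (real \<Rightarrow> real) \<Rightarrow> real \<Rightarrow> bool" where
  "is_N lam kap u0 rho0 m \<longleftrightarrow> is_max (N_val lam kap u0 rho0 ` N_dom lam kap u0 rho0) m"

text \<open>Each of the sets below has at most one element; a maximum that does not exist contributes
  nothing, so the other one is used alone.\<close>

definition is_larger_MN :: "real \<Rightarrow> real \<Rightarrow> (real \<Rightarrow> real) \<Rightarrow> (real \<Rightarrow> real) \<Rightarrow> real \<Rightarrow> bool" where
  "is_larger_MN lam kap u0 rho0 L \<longleftrightarrow>
     is_max ({m. is_M lam kap u0 rho0 m} \<union> {n. is_N lam kap u0 rho0 n}) L"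

definition alpha_bar :: "real \<Rightarrow> real \<Rightarrow> (real \<Rightarrow> real) \<Rightarrow> (real \<Rightarrow> real) \<Rightarrow> real set" where
  "alpha_bar lam kap u0 rho0 =
     {\<alpha>. \<exists>L. is_larger_MN lam kap u0 rho0 L \<and>
        (is_M lam kap u0 rho0 L \<and> \<alpha> \<in> M_dom lam kap u0 rho0 \<and> M_val lam u0 \<alpha> = L \<or>
         is_N lam kap u0 rho0 L \<and> \<alpha> \<in> N_dom lam kap u0 rho0 \<and> N_val lam kap u0 rho0 \<alpha> = L)}"

subsection \<open>The representation formulas\<close>

definition Q_poly :: "real \<Rightarrow> real \<Rightarrow> (real \<Rightarrow> real) \<Rightarrow> (real \<Rightarrow> real) \<Rightarrow> real \<Rightarrow> real poly" where
  "Q_poly lam kap u0 rho0 \<alpha> = [:1, - 2 * lam * deriv u0 \<alpha>, Cfun lam kap u0 rho0 \<alpha>:]"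

definition Q :: "real \<Rightarrow> real \<Rightarrow> (real \<Rightarrow> real) \<Rightarrow> (real \<Rightarrow> real) \<Rightarrow> real \<Rightarrow> real \<Rightarrow> real" where
  "Q lam kap u0 rho0 \<alpha> e = Cfun lam kap u0 rho0 \<alpha> * e\<^sup>2 - 2 * lam * deriv u0 \<alpha> * e + 1"

lemma poly_Q_poly: "poly (Q_poly lam kap u0 rho0 \<alpha>) e = Q lam kap u0 rho0 \<alpha> e"
  by (simp add: Q_poly_def Q_def power2_eq_square algebra_simps)

text \<open>Here the spatial mean is a function of the value e of eta, not of time.\<close>

definition P0bar :: "real \<Rightarrow> real \<Rightarrow> (real \<Rightarrow> real) \<Rightarrow> (real \<Rightarrow> real) \<Rightarrow> real \<Rightarrow> real" where
  "P0bar lam kap u0 rho0 e =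
     integral {0..1} (\<lambda>\<alpha>. Q lam kap u0 rho0 \<alpha> e powr (- (1 / (2 * lam))))"

definition is_eta_star :: "real \<Rightarrow> real \<Rightarrow> (real \<Rightarrow> real) \<Rightarrow> (real \<Rightarrow> real) \<Rightarrow> real \<Rightarrow> bool" where
  "is_eta_star lam kap u0 rho0 es \<longleftrightarrow>
     0 < es \<and> (\<exists>\<alpha>\<in>{0..1}. Q lam kap u0 rho0 \<alpha> es = 0) \<and>
     (\<forall>e. 0 < e \<and> e < es \<longrightarrow> (\<forall>\<alpha>\<in>{0..1}. Q lam kap u0 rho0 \<alpha> e \<noteq> 0))"

definition is_t_star :: "real \<Rightarrow> real \<Rightarrow> (real \<Rightarrow> real) \<Rightarrow> (real \<Rightarrow> real) \<Rightarrow> real \<Rightarrow> real \<Rightarrow> bool" where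
  "is_t_star lam kap u0 rho0 es ts \<longleftrightarrow>
     ((\<lambda>e. integral {0..e} (\<lambda>s. P0bar lam kap u0 rho0 s powr (2 * lam))) \<longlongrightarrow> ts) (at_left es)"

text \<open>The values of eta stay below its critical value, where all the powers have positive bases.\<close>

definition is_eta :: "real \<Rightarrow> real \<Rightarrow> (real \<Rightarrow> real) \<Rightarrow> (real \<Rightarrow> real) \<Rightarrow> real \<Rightarrow> real
    \<Rightarrow> (real \<Rightarrow> real) \<Rightarrow> bool" where
  "is_eta lam kap u0 rho0 es T \<eta> \<longleftrightarrow>
     \<eta> 0 = 0 \<and> strict_mono_on {0..<T} \<eta> \<and> \<eta> ` {0..<T} \<subseteq> {0..<es} \<and>
     (\<forall>t\<in>{0..<T}. (\<eta> has_real_derivative P0bar lam kap u0 rho0 (\<eta> t) powr (- 2 * lam))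
        (at t within {0..<T}))"

definition ux_formula :: "real \<Rightarrow> real \<Rightarrow> (real \<Rightarrow> real) \<Rightarrow> (real \<Rightarrow> real) \<Rightarrow> real \<Rightarrow> real \<Rightarrow> real" where
  "ux_formula lam kap u0 rho0 \<alpha> e =
     P0bar lam kap u0 rho0 e powr (- 2 * lam) / lam *
     ((lam * deriv u0 \<alpha> - e * Cfun lam kap u0 rho0 \<alpha>) / Q lam kap u0 rho0 \<alpha> e
      - 1 / P0bar lam kap u0 rho0 e *
        integral {0..1} (\<lambda>a. (lam * deriv u0 a - e * Cfun lam kap u0 rho0 a)
          / Q lam kap u0 rho0 a e powr (1 + 1 / (2 * lam))))"

definition rho_formula :: "real \<Rightarrow> real \<Rightarrow> (real \<Rightarrow> real) \<Rightarrow> (real \<Rightarrow> real) \<Rightarrow> real \<Rightarrow> real \<Rightarrow> real" where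
  "rho_formula lam kap u0 rho0 \<alpha> e =
     rho0 \<alpha> / Q lam kap u0 rho0 \<alpha> e * P0bar lam kap u0 rho0 e powr (- 2 * lam)"

subsection \<open>The initial boundary value problem\<close>

definition pdx :: "(real \<Rightarrow> real \<Rightarrow> real) \<Rightarrow> real \<Rightarrow> real \<Rightarrow> real" where
  "pdx f x t = deriv (\<lambda>y. f y t) x"

definition pdt :: "(real \<Rightarrow> real \<Rightarrow> real) \<Rightarrow> real \<Rightarrow> real \<Rightarrow> real" where
  "pdt f x t = deriv (\<lambda>s. f x s) t"

definition I_nonlocal :: "real \<Rightarrow> real \<Rightarrow> (real \<Rightarrow> real \<Rightarrow> real) \<Rightarrow> (real \<Rightarrow> real \<Rightarrow> real) \<Rightarrow> real \<Rightarrow> real" where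
  "I_nonlocal lam kap u rho t =
     - kap * integral {0..1} (\<lambda>x. (rho x t)\<^sup>2) - (1 + lam) * integral {0..1} (\<lambda>x. (pdx u x t)\<^sup>2)"

text \<open>Classical solutions on the time interval [0,T).  The equations hold for positive times, where
  every derivative that occurs in them exists and is jointly continuous; u, its x-derivative
  and rho are jointly continuous up to the initial time.\<close>

definition solves_ghs :: "real \<Rightarrow> real \<Rightarrow> (real \<Rightarrow> real) \<Rightarrow> (real \<Rightarrow> real) \<Rightarrow> real
    \<Rightarrow> (real \<Rightarrow> real \<Rightarrow> real) \<Rightarrow> (real \<Rightarrow> real \<Rightarrow> real) \<Rightarrow> bool" where
  "solves_ghs lam kap u0 rho0 T u rho \<longleftrightarrow>
     (\<forall>x. u x 0 = u0 x \<and> rho x 0 = rho0 x) \<and>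
     (\<forall>t\<in>{0..<T}. periodic1 (\<lambda>x. u x t) \<and> periodic1 (\<lambda>x. rho x t) \<and>
        integral {0..1} (\<lambda>x. u x t) = 0 \<and>
        (\<forall>x. (\<lambda>y. u y t) field_differentiable (at x))) \<and>
     continuous_on (UNIV \<times> {0..<T}) (\<lambda>(x, t). u x t) \<and>
     continuous_on (UNIV \<times> {0..<T}) (\<lambda>(x, t). pdx u x t) \<and>
     continuous_on (UNIV \<times> {0..<T}) (\<lambda>(x, t). rho x t) \<and>
     continuous_on (UNIV \<times> {0<..<T}) (\<lambda>(x, t). pdx (pdx u) x t) \<and>
     continuous_on (UNIV \<times> {0<..<T}) (\<lambda>(x, t). pdt (pdx u) x t) \<and>
     continuous_on (UNIV \<times> {0<..<T}) (\<lambda>(x, t). pdx rho x t) \<and>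
     continuous_on (UNIV \<times> {0<..<T}) (\<lambda>(x, t). pdt rho x t) \<and>
     (\<forall>t\<in>{0<..<T}. \<forall>x.
        (\<lambda>y. pdx u y t) field_differentiable (at x) \<and>
        (\<lambda>s. pdx u x s) field_differentiable (at t) \<and>
        (\<lambda>y. rho y t) field_differentiable (at x) \<and>
        (\<lambda>s. rho x s) field_differentiable (at t) \<and>
        pdt (pdx u) x t + u x t * pdx (pdx u) x t - lam * (pdx u x t)\<^sup>2 - kap * (rho x t)\<^sup>2
          = I_nonlocal lam kap u rho t \<and>
        pdt rho x t + u x t * pdx rho x t = 2 * lam * rho x t * pdx u x t)"

definition characteristics :: "real \<Rightarrow> (real \<Rightarrow> real \<Rightarrow> real) \<Rightarrow> (real \<Rightarrow> real \<Rightarrow> real) \<Rightarrow> bool" where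
  "characteristics T u \<gamma> \<longleftrightarrow>
     (\<forall>\<alpha>\<in>{0..1}. \<gamma> \<alpha> 0 = \<alpha> \<and>
        (\<forall>t\<in>{0..<T}. ((\<lambda>s. \<gamma> \<alpha> s) has_real_derivative u (\<gamma> \<alpha> t) t) (at t within {0..<T})))"

end

theory Submission
  imports Defs
begin

text \<open>The data are chosen so that \<open>Q\<close> factors.  Put \<open>S = sin\<^sup>2 (pi * a)\<close> and take
\<open>lam * u0' = (2 * S - 1) / 4\<close> and \<open>sqrt (lam * kap) * rho0 = (1 + 2 * S) / 4\<close>.  The sum of these
two functions is \<open>S\<close> and their difference is \<open>- 1 / 2\<close>, so \<open>C = - S / 2\<close> and
\<open>Q = (1 + e / 2) * (1 - e * S)\<close>.  The first factor does not depend on the position and cancels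
in the characteristic map.  The second vanishes first at \<open>e = 1\<close>, only at \<open>a = 1 / 2\<close>, where \<open>Q\<close> has a
simple root, while \<open>C\<close> vanishes only at the end points.

Write \<open>D = 1 - e * S\<close>, \<open>p = 1 / (2 * lam)\<close> and \<open>F\<close> for the integral of \<open>D powr - p\<close> over a period.
The characteristic map is \<open>G a e\<close>, the integral of \<open>D powr - p\<close> from \<open>0\<close> to \<open>a\<close> divided by \<open>F\<close>.  It is odd and
commutes with the shift by one, so the velocity that it generates is odd and periodic and has mean
zero.  The velocity gradient \<open>W\<close> and the density \<open>R\<close> are explicit functions of the label \<open>a\<close>, the
initial position, and of \<open>e\<close>; the solution is obtained by composing them with the inverse \<open>A\<close> of \<open>G\<close> and with the time
change \<open>eta\<close>.  By \<open>reduced_equation\<close> the terms of the first equation that depend on the label complete to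
a square and cancel, which leaves a function of \<open>e\<close> alone; \<open>source_eq\<close> identifies it with the nonlocal
term through three moments of the kernel.

The blow-up is governed by \<open>F\<close> and \<open>Y\<close>, where \<open>F' = p * Y\<close>.  Put \<open>X e = F e - (1 - e) * Y e\<close>.  An
integration by parts (\<open>F_le_X\<close>) bounds \<open>F\<close> by a multiple \<open>r * X\<close> for \<open>e \<ge> 1 / 2\<close>, where
\<open>1 < r < 2 * (p + 1)\<close>.  On the one
hand this is a differential inequality for \<open>F\<close> with the consequence that
\<open>F e powr (2 * lam)\<close> is at most a multiple of \<open>(1 - e) powr - (1 - 1 / r)\<close>.  This is integrable, so the blow-up
time is finite.  On the other hand it says that the local term of \<open>W\<close> at the label \<open>1 / 2\<close> exceeds the mean
term by a fixed fraction, so \<open>W\<close> tends to infinity there.  At any other label the local term stays bounded,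
and the lower bound \<open>Y_growth\<close>, which comes from a neighbourhood of the peak of width
\<open>sqrt (1 - e)\<close>, makes the mean term win.  Finally \<open>F\<close> tends to infinity exactly for \<open>lam \<le> 1\<close>, which
decides between the two limits of the density away from the peak.\<close>

section \<open>Primitives of functions on the line\<close>

text \<open>The integral of \<open>f\<close> from \<open>0\<close> to \<open>x\<close>, rescaled to the unit interval.  This form has the right
sign for negative \<open>x\<close>, and it turns dependence on the end point into dependence on a parameter.\<close>

definition prim :: "(real \<Rightarrow> real) \<Rightarrow> real \<Rightarrow> real" where
  "prim f x = x * integral {0..1} (\<lambda>s. f (x * s))"

lemma prim_0 [simp]: "prim f 0 = 0"
  by (simp add: prim_def)

lemma prim_1: "prim f 1 = integral {0..1} f"
  by (simp add: prim_def)

lemma prim_eq_diff: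
  assumes g: "\<And>y. y \<in> {a..b} \<Longrightarrow> (g has_vector_derivative f y) (at y within {a..b})"
    and 0: "0 \<in> {a..b}" and y: "y \<in> {a..b}"
  shows "prim f y = g y - g 0"
proof -
  have scaled: "y * s \<in> {a..b}" if "s \<in> {0..1}" for s
  proof (cases "0 \<le> y")
    case True
    then have "0 \<le> y * s" "y * s \<le> y" using that by (simp_all add: mult_left_le)
    then show ?thesis using 0 y by simp
  next
    case False
    then have "y * s \<le> 0" "- y * s \<le> - y" using that
      by (simp add: mult_nonpos_nonneg, intro mult_left_le) auto
    then show ?thesis using 0 y by simp
  qed
  \<comment> \<open>The substitution \<open>z = y * s\<close>, valid for both signs of \<open>y\<close>.\<close>
  have "((\<lambda>s. y * f (y * s)) has_integral (g (y * 1) - g (y * 0))) {0..1}"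
  proof (rule fundamental_theorem_of_calculus)
    fix s :: real assume s: "s \<in> {0..1}"
    have "(g has_real_derivative f (y * s)) (at (y * s) within (\<lambda>s. y * s) ` {0..1})"
      using g[OF scaled[OF s]] scaled
      by (auto simp: has_real_derivative_iff_has_vector_derivative
          intro: has_vector_derivative_within_subset)
    from DERIV_image_chain[OF this DERIV_cmult_Id]
    have "((\<lambda>s. g (y * s)) has_real_derivative y * f (y * s)) (at s within {0..1})"
      by (simp add: o_def mult.commute)
    then show "((\<lambda>s. g (y * s)) has_vector_derivative y * f (y * s)) (at s within {0..1})"
      by (simp add: has_real_derivative_iff_has_vector_derivative)
  qed simp
  from integral_unique[OF this] show ?thesis
    by (simp add: prim_def)
qed

lemma has_real_derivative_prim:
  assumes f: "continuous_on {a..b} f" and 0: "0 \<in> {a..b}" and x: "x \<in> {a<..<b}"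
  shows "(prim f has_real_derivative f x) (at x)"
proof -
  obtain g where g: "\<And>y. y \<in> {a..b} \<Longrightarrow> (g has_vector_derivative f y) (at y within {a..b})"
    using antiderivative_continuous[OF f] by blast
  have "(g has_real_derivative f x) (at x)"
    using g[of x] x at_within_Icc_at[of a x b]
    by (simp add: has_real_derivative_iff_has_vector_derivative)
  then have "((\<lambda>y. g y - g 0) has_real_derivative f x) (at x)"
    by (auto intro!: derivative_eq_intros)
  moreover have "\<forall>y\<in>{a<..<b}. g y - g 0 = prim f y"
    using prim_eq_diff[OF g 0] by simp
  ultimately show ?thesis
    using x by (auto intro: has_field_derivative_transform_within_open[where S = "{a<..<b}"])
qed

lemma prim_eq_integral:
  assumes f: "continuous_on {0..x} f" and x: "0 \<le> x"
  shows "prim f x = integral {0..x} f"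
proof -
  obtain g where g: "\<And>y. y \<in> {0..x} \<Longrightarrow> (g has_vector_derivative f y) (at y within {0..x})"
    using antiderivative_continuous[OF f] by blast
  have "prim f x = g x - g 0"
    using prim_eq_diff[OF g, where y = x] x by simp
  then show ?thesis
    using fundamental_theorem_of_calculus[OF x g] by (simp add: integral_unique)
qed

lemma prim_minus:
  assumes "\<And>y. f (- y) = f y"
  shows "prim f (- x) = - prim f x"
  using assms by (simp add: prim_def)

lemma prim_add_period:
  assumes cont: "continuous_on UNIV f" and per: "\<And>y. f (y + 1) = f y"
  shows "prim f (x + 1) = prim f x + prim f 1"
proof -
  have d: "(prim f has_real_derivative f y) (at y)" for y
    by (rule has_real_derivative_prim[of "- \<bar>y\<bar> - 1" "\<bar>y\<bar> + 1"])
      (auto intro: continuous_on_subset[OF cont])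
  have "((\<lambda>x. prim f (x + 1) - prim f x) has_real_derivative f (y + 1) - f y) (at y)" for y
    using d by (intro DERIV_diff) (simp_all flip: DERIV_shift)
  then have "\<forall>y. ((\<lambda>x. prim f (x + 1) - prim f x) has_real_derivative 0) (at y)"
    by (simp add: per)
  from DERIV_isconst_all[OF this, of x 0] show ?thesis
    by simp
qed

section \<open>The kernel and its moments\<close>

definition bump :: "real \<Rightarrow> real" where
  "bump a = (sin (pi * a))\<^sup>2"

text \<open>For the data constructed below, \<open>Q\<close> is this function times \<open>1 + e / 2\<close>.\<close>

definition dfac :: "real \<Rightarrow> real \<Rightarrow> real" where
  "dfac a e = 1 - e * bump a"

text \<open>Differentiation in \<open>e\<close> maps this family to itself, raising both indices by one; this
closure is the reason for the two indices.\<close>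

definition kern :: "nat \<Rightarrow> real \<Rightarrow> real \<Rightarrow> real \<Rightarrow> real" where
  "kern j q a e = bump a ^ j * dfac a e powr (- q)"

lemma bump_bounds: "0 \<le> bump a" "bump a \<le> 1"
  by (simp_all add: bump_def abs_square_le_1)

lemma bump_minus: "bump (- a) = bump a"
  by (simp add: bump_def)

lemma bump_add_1: "bump (a + 1) = bump a"
  by (simp add: bump_def distrib_left)

lemma bump_eq_cos: "bump a = (1 - cos (2 * pi * a)) / 2"
  using cos_double_sin[of "pi * a"] by (simp add: bump_def mult.assoc)

lemma has_real_derivative_bump [derivative_intros]:
  "(f has_real_derivative f') (at x within X) \<Longrightarrow>
   ((\<lambda>x. bump (f x)) has_real_derivative pi * sin (2 * pi * f x) * f') (at x within X)"
  unfolding bump_eq_cos by (auto intro!: derivative_eq_intros)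

lemma continuous_on_bump [continuous_intros]:
  fixes X :: "'a::t2_space set"
  shows "continuous_on X f \<Longrightarrow> continuous_on X (\<lambda>x. bump (f x))"
  unfolding bump_def by (intro continuous_intros)

lemma continuous_on_dfac [continuous_intros]:
  fixes X :: "'a::t2_space set"
  shows "continuous_on X f \<Longrightarrow> continuous_on X g \<Longrightarrow> continuous_on X (\<lambda>x. dfac (f x) (g x))"
  unfolding dfac_def by (intro continuous_intros)

lemma dfac_pos: "e < 1 \<Longrightarrow> 0 < dfac a e"
proof -
  assume "e < 1"
  have "e * bump a < 1"
  proof (cases "0 \<le> e")
    case True
    then have "e * bump a \<le> e" using bump_bounds[of a] by (simp add: mult_left_le)
    then show ?thesis using \<open>e < 1\<close> by simp
  next
    case False
    then have "e * bump a \<le> 0" using bump_bounds[of a] by (simp add: mult_nonpos_nonneg)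
    then show ?thesis by simp
  qed
  then show ?thesis
    by (simp add: dfac_def)
qed

lemma dfac_neq_0: "e < 1 \<Longrightarrow> dfac a e \<noteq> 0"
  using dfac_pos[of e a] by simp

lemma kern_minus: "kern j q (- a) e = kern j q a e"
  by (simp add: kern_def dfac_def bump_minus)

lemma kern_add_1: "kern j q (a + 1) e = kern j q a e"
  by (simp add: kern_def dfac_def bump_add_1)

lemma kern_nonneg: "0 \<le> kern j q a e"
  using bump_bounds by (simp add: kern_def)

lemma kern_0_pos: "e < 1 \<Longrightarrow> 0 < kern 0 q a e"
  using dfac_pos[of e a] by (simp add: kern_def)

lemma kern_Suc_eq:
  assumes "e < 1"
  shows "kern (Suc j) (q + 1) a e = kern j q a e * (bump a / dfac a e)"
  using dfac_pos[OF assms, of a] by (simp add: kern_def powr_diff powr_minus field_simps)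

lemma continuous_on_kern [continuous_intros]:
  fixes X :: "'a::t2_space set"
  assumes "continuous_on X f" "continuous_on X g" "\<And>x. x \<in> X \<Longrightarrow> g x < 1"
  shows "continuous_on X (\<lambda>x. kern j q (f x) (g x))"
  unfolding kern_def using assms dfac_neq_0 by (intro continuous_intros) auto

lemma kern_has_derivative_param:
  assumes "e < 1"
  shows "((\<lambda>e. kern j q a e) has_real_derivative q * kern (Suc j) (q + 1) a e) (at e within E)"
proof -
  have "((\<lambda>e. kern j q a e) has_real_derivative
      bump a ^ j * (- q * dfac a e powr - (q + 1) * (- bump a))) (at e within E)"
    unfolding kern_def dfac_def using dfac_pos[OF assms, of a]
    by (auto intro!: derivative_eq_intros simp: dfac_def powr_diff powr_minus powr_add field_simps)
  then show ?thesis
    by (simp add: kern_def mult_ac)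
qed

definition kern_prim :: "nat \<Rightarrow> real \<Rightarrow> real \<Rightarrow> real \<Rightarrow> real" where
  "kern_prim j q a e = prim (\<lambda>z. kern j q z e) a"

abbreviation moment :: "nat \<Rightarrow> real \<Rightarrow> real \<Rightarrow> real" where
  "moment j q e \<equiv> kern_prim j q 1 e"

lemma moment_eq: "moment j q e = integral {0..1} (\<lambda>a. kern j q a e)"
  by (simp add: kern_prim_def prim_1)

lemma kern_has_integral:
  assumes "e < 1"
  shows "((\<lambda>a. kern j q a e) has_integral moment j q e) {0..1}"
  unfolding moment_eq using assms
  by (intro integrable_integral integrable_continuous_real continuous_intros) auto

lemma kern_prim_minus: "kern_prim j q (- a) e = - kern_prim j q a e"
  unfolding kern_prim_def by (rule prim_minus) (rule kern_minus)

lemma kern_prim_add_1: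
  assumes "e < 1"
  shows "kern_prim j q (a + 1) e = kern_prim j q a e + moment j q e"
  unfolding kern_prim_def using assms
  by (intro prim_add_period continuous_intros) (auto simp: kern_add_1)

lemma kern_prim_has_derivative_space:
  assumes "e < 1"
  shows "((\<lambda>a. kern_prim j q a e) has_real_derivative kern j q a e) (at a within X)"
proof -
  have "(prim (\<lambda>z. kern j q z e) has_real_derivative kern j q a e) (at a)"
    by (rule has_real_derivative_prim[of "- \<bar>a\<bar> - 1" "\<bar>a\<bar> + 1"])
      (use assms in \<open>auto intro!: continuous_intros\<close>)
  then show ?thesis
    unfolding kern_prim_def by (rule has_field_derivative_at_within)
qed

lemma kern_prim_has_derivative_param:
  assumes "e < 1"
  shows "((\<lambda>e. kern_prim j q a e) has_real_derivative q * kern_prim (Suc j) (q + 1) a e)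
    (at e within E)"
proof -
  have "((\<lambda>e. integral (cbox 0 1) (\<lambda>s. kern j q (a * s) e)) has_real_derivative
      integral (cbox 0 1) (\<lambda>s. q * kern (Suc j) (q + 1) (a * s) e)) (at e within {..<1})"
  proof (rule leibniz_rule_field_derivative)
    show "((\<lambda>e. kern j q (a * s) e) has_real_derivative q * kern (Suc j) (q + 1) (a * s) e')
        (at e' within {..<1})" if "e' \<in> {..<1}" for e' s
      using that by (intro kern_has_derivative_param) simp
    show "(\<lambda>s. kern j q (a * s) e') integrable_on cbox 0 1" if "e' \<in> {..<1}" for e'
      using that unfolding cbox_interval
      by (intro integrable_continuous_real continuous_intros) simp
    show "continuous_on ({..<1} \<times> cbox 0 1) (\<lambda>(e, s). q * kern (Suc j) (q + 1) (a * s) e)"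
      unfolding split_beta by (intro continuous_intros) auto
  qed (use assms in auto)
  then have "((\<lambda>e. integral {0..1} (\<lambda>s. kern j q (a * s) e)) has_real_derivative
      integral {0..1} (\<lambda>s. q * kern (Suc j) (q + 1) (a * s) e)) (at e)"
    using assms at_within_open[of e "{..<1}"] by simp
  from has_field_derivative_at_within[OF DERIV_cmult[OF this, of a], of E] show ?thesis
    unfolding kern_prim_def prim_def by (simp only: integral_mult_right mult.left_commute)
qed

lemma continuous_on_kern_prim [continuous_intros]:
  fixes X :: "'a::t2_space set"
  assumes f: "continuous_on X f" and g: "continuous_on X g" and less: "\<And>x. x \<in> X \<Longrightarrow> g x < 1"
  shows "continuous_on X (\<lambda>x. kern_prim j q (f x) (g x))"
proof -
  have "continuous_on (X \<times> cbox 0 1) (\<lambda>z. kern j q (f (fst z) * snd z) (g (fst z)))"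
    using less
    by (auto intro!: continuous_intros continuous_on_compose2[OF f] continuous_on_compose2[OF g])
  then have "continuous_on X (\<lambda>x. integral (cbox 0 1) (\<lambda>s. kern j q (f x * s) (g x)))"
    by (intro integral_continuous_on_param) (simp add: split_beta)
  then show ?thesis
    unfolding kern_prim_def prim_def using f by (auto intro!: continuous_intros)
qed

text \<open>Continuity of one partial derivative suffices.  For the characteristic map it is the one in the
parameter, which is again an integral of a kernel.\<close>

lemma has_derivative_of_partials:
  fixes f :: "real \<Rightarrow> real \<Rightarrow> real"
  assumes fx: "((\<lambda>x. f x y) has_real_derivative a) (at x)"
    and fy: "\<And>x y. y \<in> Y \<Longrightarrow> ((\<lambda>y. f x y) has_real_derivative b x y) (at y)"
    and cont: "continuous_on (UNIV \<times> Y) (\<lambda>(x, y). b x y)"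
    and y: "y \<in> Y" and Y: "open Y" "convex Y"
  shows "((\<lambda>(x, y). f x y) has_derivative (\<lambda>(dx, dy). a * dx + b x y * dy)) (at (x, y))"
proof -
  have "((\<lambda>(x, y). f x y) has_derivative
      (\<lambda>(dx, dy). a * dx + blinfun_mult_right (b x y) dy)) (at (x, y) within UNIV \<times> Y)"
  proof (rule has_derivative_partialsI)
    show "((\<lambda>x. f x y) has_derivative (*) a) (at x)"
      using fx by (simp add: has_field_derivative_def)
    show "((\<lambda>y. f x' y) has_derivative blinfun_mult_right (b x' y')) (at y' within Y)"
      if "y' \<in> Y" for x' y'
      using has_derivative_at_withinI[OF fy[OF that, of x', unfolded has_field_derivative_def], of Y]
      by (simp only: blinfun_mult_right.rep_eq)
    have "continuous_on (UNIV \<times> Y) (\<lambda>z. blinfun_mult_right (b (fst z) (snd z)))"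
      using cont by (intro bounded_linear.continuous_on[OF bounded_linear_blinfun_mult_right])
        (simp add: split_beta)
    then have "continuous (at (x, y) within UNIV \<times> Y) (\<lambda>z. blinfun_mult_right (b (fst z) (snd z)))"
      unfolding continuous_on_eq_continuous_within using y by (elim bspec) simp
    then show "continuous (at (x, y) within UNIV \<times> Y) (\<lambda>(x, y). blinfun_mult_right (b x y))"
      by (simp only: case_prod_beta')
  qed (fact y, fact Y(2))
  moreover have "at (x, y) within UNIV \<times> Y = at (x, y)"
    using y Y by (intro at_within_open open_Times) auto
  ultimately show ?thesis
    by (simp only: blinfun_mult_right.rep_eq)
qed

section \<open>Integral inequalities behind the growth rates\<close>

lemma mult_cos_le_sin:
  fixes z :: real
  assumes "0 \<le> z" "z \<le> pi / 2"
  shows "z * cos z \<le> sin z"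
proof -
  have "sin 0 - 0 * cos 0 \<le> sin z - z * cos z"
  proof (rule DERIV_nonneg_imp_nondecreasing[OF assms(1)])
    fix x assume x: "0 \<le> x" "x \<le> z"
    have "((\<lambda>x. sin x - x * cos x) has_real_derivative x * sin x) (at x)"
      by (auto intro!: derivative_eq_intros)
    moreover have "0 \<le> x * sin x"
      using x assms by (intro mult_nonneg_nonneg sin_ge_zero) auto
    ultimately show "\<exists>y. ((\<lambda>x. sin x - x * cos x) has_real_derivative y) (at x) \<and> 0 \<le> y"
      by blast
  qed
  then show ?thesis by simp
qed

text \<open>After division by \<open>sin z\<close> this is \<open>z * cos z \<le> sin z\<close>; both sides are even in \<open>z\<close>.\<close>

lemma mult_sin_cos_le_sin_square:
  fixes z :: real
  assumes "\<bar>z\<bar> \<le> pi / 2"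
  shows "z * (sin z * cos z) \<le> (sin z)\<^sup>2"
proof -
  have pos: "x * (sin x * cos x) \<le> (sin x)\<^sup>2" if "0 \<le> x" "x \<le> pi / 2" for x :: real
    using mult_right_mono[OF mult_cos_le_sin[OF that], of "sin x"] sin_ge_zero[of x] that
    by (simp add: power2_eq_square mult_ac)
  show ?thesis
    using pos[of z] pos[of "- z"] assms by (cases "0 \<le> z") auto
qed

lemma bump_shift: "bump (y + 1 / 2) = 1 - (sin (pi * y))\<^sup>2"
  by (simp add: bump_def distrib_left sin_add flip: cos_squared_eq)

text \<open>The weight that appears when the kernel is integrated by parts against \<open>a - 1 / 2\<close> is dominated
by the function \<open>1 - bump a\<close>, which defines the quantity \<open>X\<close> below.\<close>

lemma bump_slope_le:
  assumes "a \<in> {0..1}"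
  shows "- ((a - 1 / 2) * (pi * sin (2 * pi * a))) \<le> 2 * (1 - bump a)"
proof -
  define z where "z = pi * (a - 1 / 2)"
  have "\<bar>z\<bar> = pi * \<bar>a - 1 / 2\<bar>" by (simp add: z_def abs_mult)
  also have "\<dots> \<le> pi * (1 / 2)" using assms by (intro mult_left_mono) (auto simp: abs_if)
  finally have z: "\<bar>z\<bar> \<le> pi / 2" by simp
  have "2 * pi * a = 2 * z + pi" by (simp add: z_def algebra_simps)
  then have "sin (2 * pi * a) = - (2 * sin z * cos z)" by (simp add: sin_double)
  moreover have "1 - bump a = (sin z)\<^sup>2"
    using bump_shift[of "a - 1 / 2"] by (simp add: z_def)
  moreover have "(a - 1 / 2) * pi = z" by (simp add: z_def)
  ultimately show ?thesis
    using mult_sin_cos_le_sin_square[OF z] by (simp flip: mult.assoc)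
qed

lemma kern_has_derivative_space:
  assumes "e < 1"
  shows "((\<lambda>a. kern 0 q a e) has_real_derivative
    q * e * (pi * sin (2 * pi * a)) * kern 0 (q + 1) a e) (at a within X)"
  unfolding kern_def dfac_def using dfac_pos[OF assms, of a]
  by (auto intro!: derivative_eq_intros simp: dfac_def powr_diff powr_minus powr_add field_simps)

lemma kern_0_eq:
  assumes "e < 1"
  shows "kern 0 q a e = dfac a e * kern 0 (q + 1) a e"
  using dfac_pos[OF assms, of a] powr_add[of "dfac a e" 1 "- (q + 1)"] by (simp add: kern_def)

lemma kern_at_0_1: "kern 0 q 0 e = 1" "kern 0 q 1 e = 1"
  by (simp_all add: kern_def dfac_def bump_def)

lemma kern_0_ge_1:
  assumes "0 \<le> e" "e < 1" "0 \<le> q"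
  shows "1 \<le> kern 0 q a e"
proof -
  have "dfac a e \<le> 1" using bump_bounds assms by (simp add: dfac_def)
  then have "dfac a e powr q \<le> 1"
    using dfac_pos[OF assms(2), of a] assms(3) powr_mono2[of q "dfac a e" 1] by simp
  then show ?thesis
    using dfac_pos[OF assms(2), of a] by (simp add: kern_def powr_minus field_simps)
qed

locale ghs_data =
  fixes lam kap :: real
  assumes lam_pos: "0 < lam" and kap_pos: "0 < kap"
begin

definition p :: real where "p = 1 / (2 * lam)"

lemma p_pos: "0 < p" and two_lam_p: "2 * lam * p = 1"
  using lam_pos by (simp_all add: p_def)

text \<open>The moments of order zero, one and two.  \<open>Y\<close> and \<open>Z\<close> are, up to constants, the first two
derivatives of \<open>F\<close>.\<close>

definition F :: "real \<Rightarrow> real" where "F = moment 0 p"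
definition Y :: "real \<Rightarrow> real" where "Y = moment 1 (p + 1)"
definition Z :: "real \<Rightarrow> real" where "Z = moment 2 (p + 2)"
text \<open>Up to a common factor, at the peak \<open>1 / 2\<close> the local term of the velocity gradient is \<open>1 / (1 - e)\<close> and the mean
term is \<open>Y e / F e\<close>; their difference is \<open>X e / ((1 - e) * F e)\<close>.\<close>

definition X :: "real \<Rightarrow> real" where "X e = F e - (1 - e) * Y e"

lemma F_deriv: "e < 1 \<Longrightarrow> (F has_real_derivative p * Y e) (at e within E)"
  using kern_prim_has_derivative_param[of e 0 p 1 E] by (simp add: F_def Y_def)

lemma Y_deriv: "e < 1 \<Longrightarrow> (Y has_real_derivative (p + 1) * Z e) (at e within E)"
  using kern_prim_has_derivative_param[of e 1 "p + 1" 1 E]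
  by (simp add: Y_def Z_def numeral_2_eq_2 add.assoc)

lemma F_pos: assumes "e < 1" shows "0 < F e"
proof -
  have "0 \<noteq> integral {0..1} (\<lambda>a. kern 0 p a e)"
    using assms kern_nonneg
    by (subst eq_commute, subst integral_eq_0_iff)
      (auto intro!: continuous_intros bexI[of _ 0] simp: kern_at_0_1)
  moreover have "0 \<le> integral {0..1} (\<lambda>a. kern 0 p a e)"
    using kern_nonneg by (intro integral_nonneg integrable_continuous_real continuous_intros assms)
  ultimately show ?thesis by (simp add: F_def moment_eq)
qed

lemma F_ge_1: assumes "0 \<le> e" "e < 1" shows "1 \<le> F e"
  using has_integral_le[OF has_integral_const_real[of 1 0 1] kern_has_integral[OF assms(2), of 0 p]]
    kern_0_ge_1[OF assms] p_pos by (simp add: F_def)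

lemma Y_nonneg: "e < 1 \<Longrightarrow> 0 \<le> Y e"
  using has_integral_nonneg[OF kern_has_integral[of e 1 "p + 1"]] kern_nonneg by (simp add: Y_def)

text \<open>The combination \<open>dfac a e - (1 - e) * bump a\<close> is \<open>1 - bump a\<close>, which makes \<open>X\<close> visibly positive.\<close>

lemma X_has_integral:
  assumes "e < 1"
  shows "((\<lambda>a. (1 - bump a) * kern 0 (p + 1) a e) has_integral X e) {0..1}"
proof -
  have "kern 0 p a e - (1 - e) * kern 1 (p + 1) a e = (1 - bump a) * kern 0 (p + 1) a e" for a
  proof -
    have "kern 0 p a e = dfac a e * kern 0 (p + 1) a e"
      by (rule kern_0_eq[OF assms])
    moreover have "kern 1 (p + 1) a e = bump a * kern 0 (p + 1) a e"
      by (simp add: kern_def)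
    ultimately show ?thesis by (simp add: dfac_def algebra_simps)
  qed
  with has_integral_diff[OF kern_has_integral[OF assms, of 0 p]
      has_integral_mult_right[OF kern_has_integral[OF assms, of 1 "p + 1"], of "1 - e"]]
  show ?thesis by (simp add: X_def F_def Y_def)
qed

text \<open>Integration by parts of the kernel against \<open>a - 1 / 2\<close>.  The boundary terms add up to one because
the kernel equals one at both ends of the period.\<close>

lemma F_le_X:
  assumes e: "0 \<le> e" "e < 1"
  shows "F e \<le> 1 + 2 * p * X e"
proof -
  define w where "w a = (a - 1 / 2) * (pi * sin (2 * pi * a))" for a :: real
  have "((\<lambda>a. kern 0 p a e + p * e * w a * kern 0 (p + 1) a e) has_integral
      (1 - 1 / 2) * kern 0 p 1 e - (0 - 1 / 2) * kern 0 p 0 e) {0..1}"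
  proof (rule fundamental_theorem_of_calculus)
    fix a :: real
    show "((\<lambda>a. (a - 1 / 2) * kern 0 p a e) has_vector_derivative
        kern 0 p a e + p * e * w a * kern 0 (p + 1) a e) (at a within {0..1})"
      unfolding has_real_derivative_iff_has_vector_derivative[symmetric]
      by (rule derivative_eq_intros kern_has_derivative_space[OF e(2)] refl)+ (simp add: w_def)
  qed simp
  then have int1: "((\<lambda>a. kern 0 p a e + p * e * w a * kern 0 (p + 1) a e) has_integral 1) {0..1}"
    by (simp add: kern_at_0_1)
  have int2: "((\<lambda>a. kern 0 p a e - 2 * p * ((1 - bump a) * kern 0 (p + 1) a e)) has_integral
      (F e - 2 * p * X e)) {0..1}"
    unfolding F_def
    by (intro has_integral_diff has_integral_mult_right kern_has_integral X_has_integral e)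
  have "F e - 2 * p * X e \<le> 1"
  proof (rule has_integral_le[OF int2 int1])
    fix a :: real assume "a \<in> {0..1}"
    then have "- w a \<le> 2 * (1 - bump a)"
      unfolding w_def by (rule bump_slope_le)
    then have "e * (- w a) \<le> e * (2 * (1 - bump a))"
      using e(1) by (rule mult_left_mono)
    also have "\<dots> \<le> 2 * (1 - bump a)"
      using e bump_bounds[of a] by (intro mult_left_le_one_le) auto
    finally have "p * kern 0 (p + 1) a e * (e * (- w a)) \<le> p * kern 0 (p + 1) a e * (2 * (1 - bump a))"
      using p_pos kern_nonneg by (intro mult_left_mono) auto
    then show "kern 0 p a e - 2 * p * ((1 - bump a) * kern 0 (p + 1) a e)
        \<le> kern 0 p a e + p * e * w a * kern 0 (p + 1) a e"
      by (simp add: algebra_simps)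
  qed
  then show ?thesis by simp
qed

text \<open>The value \<open>1 / 2\<close> is not enough later on: it would turn the constant \<open>r\<close> into \<open>2 * (p + 1)\<close>, the
borderline case of \<open>h_ratio_at_top\<close>.  The estimate \<open>1 + e * bump a \<le> 1 / dfac a e\<close> gains the extra
\<open>e / 8\<close>.\<close>

lemma X_ge:
  assumes e: "0 \<le> e" "e < 1"
  shows "1 / 2 + e / 8 \<le> X e"
proof -
  define g where "g a = a / 2 + sin (2 * pi * a) / (4 * pi) + e * (a / 8 - sin (4 * pi * a) / (32 * pi))"
    for a :: real
  have "((\<lambda>a. (1 - bump a) * (1 + e * bump a)) has_integral g 1 - g 0) {0..1}"
  proof (rule fundamental_theorem_of_calculus)
    fix a :: real
    have c4: "cos (4 * pi * a) = 2 * (cos (2 * pi * a))\<^sup>2 - 1"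
      using cos_double_cos[of "2 * pi * a"] by (simp add: mult.assoc)
    have "(g has_real_derivative
        1 / 2 + cos (2 * pi * a) / 2 + e * (1 / 8 - cos (4 * pi * a) / 8)) (at a within {0..1})"
      unfolding g_def by (auto intro!: derivative_eq_intros)
    also have "1 / 2 + cos (2 * pi * a) / 2 + e * (1 / 8 - cos (4 * pi * a) / 8)
        = (1 - bump a) * (1 + e * bump a)"
      unfolding c4 bump_eq_cos by (simp add: field_simps power2_eq_square)
    finally show "(g has_vector_derivative (1 - bump a) * (1 + e * bump a)) (at a within {0..1})"
      by (simp add: has_real_derivative_iff_has_vector_derivative)
  qed simp
  moreover have "g 1 - g 0 = 1 / 2 + e / 8"
    using sin_npi2[of 4] by (simp add: g_def mult.commute)
  ultimately have "((\<lambda>a. (1 - bump a) * (1 + e * bump a)) has_integral 1 / 2 + e / 8) {0..1}"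
    by simp
  then show ?thesis
  proof (rule has_integral_le[OF _ X_has_integral[OF e(2)]])
    fix a :: real
    have D: "0 < dfac a e" by (rule dfac_pos) fact
    have "1 + e * bump a \<le> 1 / dfac a e"
    proof -
      have "(1 + e * bump a) * dfac a e = 1 - (e * bump a)\<^sup>2"
        by (simp add: dfac_def power2_eq_square algebra_simps)
      then show ?thesis using D by (simp add: pos_le_divide_eq)
    qed
    also have "\<dots> \<le> 1 / dfac a e * kern 0 p a e"
      using kern_0_ge_1[OF e, of p a] p_pos D by (simp add: divide_right_mono)
    also have "\<dots> = kern 0 (p + 1) a e"
      using kern_0_eq[OF e(2), of p a] D by simp
    finally show "(1 - bump a) * (1 + e * bump a) \<le> (1 - bump a) * kern 0 (p + 1) a e"
      using bump_bounds by (intro mult_left_mono) auto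
  qed
qed

text \<open>For \<open>e \<ge> 1 / 2\<close> the bound \<open>X_ge\<close> gives \<open>1 \<le> 16 / 9 * X e\<close>.\<close>

definition r :: real where "r = 2 * p + 16 / 9"

lemma r_bounds: "1 < r" "r < 2 * (p + 1)"
  using p_pos by (simp_all add: r_def)

lemma F_le_r_X:
  assumes "1 / 2 \<le> e" "e < 1"
  shows "F e \<le> r * X e"
  using F_le_X[of e] X_ge[of e] assms by (simp add: r_def algebra_simps)

definition m :: real where "m = p * (1 - 1 / r)"

text \<open>By \<open>F_le_r_X\<close> the derivative \<open>p * Y e = p * (F e - X e) / (1 - e)\<close> is at most \<open>m * F e / (1 - e)\<close>, so
\<open>F e * (1 - e) powr m\<close> does not increase.\<close>

lemma F_growth:
  obtains K where "0 < K" "\<And>e. 1 / 2 \<le> e \<Longrightarrow> e < 1 \<Longrightarrow> F e \<le> K * (1 - e) powr (- m)"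
proof
  show "0 < F (1 / 2) * (1 / 2) powr m" using F_pos[of "1 / 2"] by simp
  fix e :: real assume e: "1 / 2 \<le> e" "e < 1"
  have "F e * (1 - e) powr m \<le> F (1 / 2) * (1 - 1 / 2) powr m"
  proof (rule DERIV_nonpos_imp_nonincreasing[OF e(1)])
    fix x assume x: "1 / 2 \<le> x" "x \<le> e"
    then have x1: "x < 1" using e by simp
    have "((\<lambda>x. F x * (1 - x) powr m) has_real_derivative
        p * Y x * (1 - x) powr m - F x * (m * (1 - x) powr (m - 1))) (at x)"
      using x1 by (auto intro!: derivative_eq_intros F_deriv simp: field_simps powr_diff)
    also have "p * Y x * (1 - x) powr m - F x * (m * (1 - x) powr (m - 1))
        = (1 - x) powr (m - 1) * (p * ((1 - x) * Y x) - m * F x)"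
      using x1 by (simp add: powr_diff field_simps)
    also have "\<dots> = (1 - x) powr (m - 1) * p * (F x / r - X x)"
      using r_bounds by (simp add: X_def m_def field_simps)
    finally have "((\<lambda>x. F x * (1 - x) powr m) has_real_derivative
        (1 - x) powr (m - 1) * p * (F x / r - X x)) (at x)" .
    moreover have "F x / r - X x \<le> 0"
      using F_le_r_X[OF x(1) x1] r_bounds by (simp add: pos_divide_le_eq mult.commute)
    then have "(1 - x) powr (m - 1) * p * (F x / r - X x) \<le> 0"
      using p_pos by (intro mult_nonneg_nonpos) auto
    ultimately show "\<exists>y. ((\<lambda>x. F x * (1 - x) powr m) has_real_derivative y) (at x) \<and> y \<le> 0"
      by blast
  qed
  then show "F e \<le> F (1 / 2) * (1 / 2) powr m * (1 - e) powr (- m)"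
    using e by (simp add: powr_minus field_simps)
qed

text \<open>Within distance \<open>sqrt (1 - e)\<close> of the peak, \<open>dfac\<close> is comparable to \<open>1 - e\<close>.\<close>

lemma Y_growth:
  obtains c where "0 < c"
    "\<And>e. 31 / 32 \<le> e \<Longrightarrow> e < 1 \<Longrightarrow> c * (1 - e) powr (- (p + 1 / 2)) \<le> Y e"
proof
  \<comment> \<open>The constant 17 is \<open>1 + 4\<^sup>2\<close>, from \<open>pi < 4\<close>; for \<open>1 - e \<le> 1 / 32\<close> the bump is still at least \<open>1 / 2\<close> on the
    neighbourhood used.\<close>
  show "0 < 17 powr (- (p + 1)) / (2::real)" by simp
  fix e :: real assume e: "31 / 32 \<le> e" "e < 1"
  define d where "d = sqrt (1 - e)"
  define b where "b = (1 / 2) * (17 * (1 - e)) powr (- (p + 1))"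
  have d2: "d\<^sup>2 = 1 - e" using e by (simp add: d_def)
  have "d\<^sup>2 \<le> (1 / 2)\<^sup>2" using d2 e by (simp add: power2_eq_square)
  then have d: "0 \<le> d" "d \<le> 1 / 2"
    using e by (auto simp: d_def intro: power2_le_imp_le)
  have lower: "b \<le> kern 1 (p + 1) a e" if a: "a \<in> {1 / 2..1 / 2 + d}" for a
  proof -
    define y where "y = a - 1 / 2"
    have y: "0 \<le> y" "y \<le> d" using a by (auto simp: y_def)
    have "(sin (pi * y))\<^sup>2 \<le> (pi * y)\<^sup>2"
      using abs_sin_le_one abs_sin_x_le_abs_x[of "pi * y"] by (simp add: abs_le_square_iff)
    also have "\<dots> \<le> (4 * d)\<^sup>2"
      using y d pi_less_4 by (intro power_mono mult_mono) auto
    also have "\<dots> = 16 * (1 - e)" using d2 by (simp add: power_mult_distrib)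
    finally have s: "(sin (pi * y))\<^sup>2 \<le> 16 * (1 - e)" .
    have bump: "bump a = 1 - (sin (pi * y))\<^sup>2" using bump_shift[of y] by (simp add: y_def)
    have "dfac a e = (1 - e) + e * (sin (pi * y))\<^sup>2"
      by (simp add: dfac_def bump algebra_simps)
    also have "\<dots> \<le> (1 - e) + (sin (pi * y))\<^sup>2"
      using e by (intro add_left_mono mult_left_le_one_le) auto
    finally have "dfac a e \<le> 17 * (1 - e)" using s by simp
    then have "(17 * (1 - e)) powr (- (p + 1)) \<le> dfac a e powr (- (p + 1))"
      using p_pos dfac_pos[OF e(2), of a] by (intro powr_mono2') auto
    moreover have "1 / 2 \<le> bump a" using s e by (simp add: bump)
    ultimately show ?thesis
      unfolding b_def kern_def by (intro mult_mono) auto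
  qed
  have "17 powr (- (p + 1)) / 2 * (1 - e) powr (- (p + 1 / 2)) = d * b"
  proof -
    have "d = (1 - e) powr (1 / 2)" using e by (simp add: d_def powr_half_sqrt)
    then have "d * b = (1 / 2) * 17 powr (- (p + 1)) * ((1 - e) powr (1 / 2) * (1 - e) powr (- (p + 1)))"
      using e powr_mult[of 17 "1 - e" "- (p + 1)"] unfolding b_def by simp
    also have "(1 - e) powr (1 / 2) * (1 - e) powr (- (p + 1)) = (1 - e) powr (- (p + 1 / 2))"
      unfolding powr_add[symmetric] by (rule arg_cong[where f = "(powr) (1 - e)"]) simp
    finally show ?thesis by simp
  qed
  also have "d * b = integral {1 / 2..1 / 2 + d} (\<lambda>a. b)"
    using d by simp
  also have "\<dots> \<le> integral {1 / 2..1 / 2 + d} (\<lambda>a. kern 1 (p + 1) a e)"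
    using lower e by (intro integral_le integrable_continuous_real continuous_intros) auto
  also have "\<dots> \<le> integral {0..1} (\<lambda>a. kern 1 (p + 1) a e)"
    using d e kern_nonneg
    by (intro integral_subset_le integrable_continuous_real continuous_intros) auto
  also have "\<dots> = Y e" by (simp add: Y_def moment_eq)
  finally show "17 powr (- (p + 1)) / 2 * (1 - e) powr (- (p + 1 / 2)) \<le> Y e" .
qed

end

section \<open>The characteristic map and its inverse\<close>

context ghs_data
begin

lemma continuous_on_F [continuous_intros]:
  fixes X :: "'a::t2_space set"
  shows "continuous_on X g \<Longrightarrow> (\<And>x. x \<in> X \<Longrightarrow> g x < 1) \<Longrightarrow> continuous_on X (\<lambda>x. F (g x))"
  unfolding F_def by (intro continuous_intros)

lemma continuous_on_Y [continuous_intros]: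
  fixes X :: "'a::t2_space set"
  shows "continuous_on X g \<Longrightarrow> (\<And>x. x \<in> X \<Longrightarrow> g x < 1) \<Longrightarrow> continuous_on X (\<lambda>x. Y (g x))"
  unfolding Y_def by (intro continuous_intros)

lemma continuous_on_Z [continuous_intros]:
  fixes X :: "'a::t2_space set"
  shows "continuous_on X g \<Longrightarrow> (\<And>x. x \<in> X \<Longrightarrow> g x < 1) \<Longrightarrow> continuous_on X (\<lambda>x. Z (g x))"
  unfolding Z_def by (intro continuous_intros)

lemma F_neq_0: "e < 1 \<Longrightarrow> F e \<noteq> 0"
  using F_pos[of e] by simp

definition G :: "real \<Rightarrow> real \<Rightarrow> real" where
  "G a e = kern_prim 0 p a e / F e"

text \<open>The names \<open>Ga\<close> and \<open>Ge\<close> stand for the partial derivatives of \<open>G\<close>; the same convention is used for \<open>W\<close>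
and \<open>R\<close> below.\<close>

definition Ga :: "real \<Rightarrow> real \<Rightarrow> real" where
  "Ga a e = kern 0 p a e / F e"

definition Ge :: "real \<Rightarrow> real \<Rightarrow> real" where
  "Ge a e = p * (kern_prim 1 (p + 1) a e * F e - kern_prim 0 p a e * Y e) / (F e)\<^sup>2"

lemma Ga_pos: "e < 1 \<Longrightarrow> 0 < Ga a e"
  by (simp add: Ga_def kern_0_pos F_pos)

lemma G_deriv_space: "e < 1 \<Longrightarrow> ((\<lambda>a. G a e) has_real_derivative Ga a e) (at a within S)"
  unfolding G_def Ga_def by (intro DERIV_cdivide kern_prim_has_derivative_space)

lemma G_deriv_param:
  assumes "e < 1"
  shows "((\<lambda>e. G a e) has_real_derivative Ge a e) (at e within S)"
proof -
  have "((\<lambda>e. G a e) has_real_derivative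
      (p * kern_prim 1 (p + 1) a e * F e - kern_prim 0 p a e * (p * Y e)) / (F e * F e)) (at e within S)"
    unfolding G_def using F_neq_0[OF assms]
      kern_prim_has_derivative_param[OF assms, of 0 p a S] F_deriv[OF assms, of S]
    by (intro DERIV_divide) auto
  then show ?thesis
    by (simp add: Ge_def power2_eq_square right_diff_distrib mult_ac)
qed

lemma Ge_deriv_space:
  assumes "e < 1"
  shows "((\<lambda>a. Ge a e) has_real_derivative Ga a e * (p * (bump a / dfac a e - Y e / F e)))
    (at a within S)"
proof -
  have "((\<lambda>a. Ge a e) has_real_derivative
      p * (kern 1 (p + 1) a e * F e - kern 0 p a e * Y e) / (F e)\<^sup>2) (at a within S)"
    unfolding Ge_def
    by (intro DERIV_cdivide DERIV_cmult DERIV_diff DERIV_cmult_right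
        kern_prim_has_derivative_space assms)
  moreover have "kern 1 (p + 1) a e = kern 0 p a e * (bump a / dfac a e)"
    using kern_Suc_eq[OF assms, of 0] by simp
  ultimately show ?thesis
    using F_neq_0[OF assms] by (simp add: Ga_def power2_eq_square field_simps)
qed

lemma continuous_on_Ga [continuous_intros]:
  fixes X :: "'a::t2_space set"
  assumes "continuous_on X f" "continuous_on X g" "\<And>x. x \<in> X \<Longrightarrow> g x < 1"
  shows "continuous_on X (\<lambda>x. Ga (f x) (g x))"
  unfolding Ga_def using assms F_neq_0 by (intro continuous_intros) auto

lemma continuous_on_Ge [continuous_intros]:
  fixes X :: "'a::t2_space set"
  assumes "continuous_on X f" "continuous_on X g" "\<And>x. x \<in> X \<Longrightarrow> g x < 1"
  shows "continuous_on X (\<lambda>x. Ge (f x) (g x))"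
  unfolding Ge_def using assms F_neq_0 by (intro continuous_intros) auto

lemma G_has_derivative:
  assumes "e < 1"
  shows "((\<lambda>(a, e). G a e) has_derivative (\<lambda>(da, de). Ga a e * da + Ge a e * de)) (at (a, e))"
proof (rule has_derivative_of_partials[where Y = "{..<1}"])
  show "continuous_on (UNIV \<times> {..<1}) (\<lambda>(a, e). Ge a e)"
    unfolding split_beta by (intro continuous_intros) auto
qed (use assms in \<open>auto intro: G_deriv_space G_deriv_param\<close>)

lemma G_strict_mono:
  assumes "e < 1" "a < b"
  shows "G a e < G b e"
proof (rule DERIV_pos_imp_increasing[OF assms(2)])
  show "\<exists>y. ((\<lambda>a. G a e) has_real_derivative y) (at x) \<and> 0 < y" for x
    using G_deriv_space[OF assms(1), of x UNIV] Ga_pos[OF assms(1), of x] by blast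
qed

lemma G_0: "G 0 e = 0"
  by (simp add: G_def kern_prim_def)

lemma G_minus: "G (- a) e = - G a e"
  by (simp add: G_def kern_prim_minus)

lemma G_add_1: "e < 1 \<Longrightarrow> G (a + 1) e = G a e + 1"
  using F_neq_0[of e] by (simp add: G_def kern_prim_add_1 add_divide_distrib F_def)

lemma G_of_nat: "e < 1 \<Longrightarrow> G (real n) e = real n"
proof (induction n)
  case (Suc n)
  then show ?case using G_add_1[of e "real n"] by (simp add: add.commute)
qed (simp add: G_0)

lemma G_surj:
  assumes "e < 1"
  shows "\<exists>a. G a e = x"
proof -
  obtain n where n: "\<bar>x\<bar> \<le> real n" using real_arch_simple by blast
  have "\<exists>a\<ge>- real n. a \<le> real n \<and> G a e = x"
  proof (rule IVT)
    show "G (- real n) e \<le> x" "x \<le> G (real n) e"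
      using n by (auto simp: G_minus G_of_nat[OF assms])
    show "\<forall>a. - real n \<le> a \<and> a \<le> real n \<longrightarrow> isCont (\<lambda>a. G a e) a"
      using DERIV_isCont[OF G_deriv_space[OF assms]] by simp
  qed simp
  then show ?thesis by blast
qed

definition A :: "real \<Rightarrow> real \<Rightarrow> real" where
  "A x e = (THE a. G a e = x)"

lemma G_A: "e < 1 \<Longrightarrow> G (A x e) e = x"
  and A_G: "e < 1 \<Longrightarrow> A (G a e) e = a"
proof -
  assume e: "e < 1"
  have uniq: "a = b" if "G a e = G b e" for a b
    using that G_strict_mono[OF e, of a b] G_strict_mono[OF e, of b a] by linarith
  have "\<exists>!a. G a e = x" for x
    using G_surj[OF e, of x] uniq by blast
  then show GA: "G (A x e) e = x" for x
    unfolding A_def by (rule theI')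
  show "A (G a e) e = a"
    by (rule uniq) (rule GA)
qed

text \<open>These two equivalences turn joint continuity of the inverse into continuity of \<open>G\<close> in \<open>e\<close>.\<close>

lemma less_A_iff: "e < 1 \<Longrightarrow> a < A x e \<longleftrightarrow> G a e < x"
  using G_strict_mono[of e a "A x e"] G_strict_mono[of e "A x e" a] G_A[of e x]
  by (cases a "A x e" rule: linorder_cases) auto

lemma A_less_iff: "e < 1 \<Longrightarrow> A x e < a \<longleftrightarrow> x < G a e"
  using G_strict_mono[of e a "A x e"] G_strict_mono[of e "A x e" a] G_A[of e x]
  by (cases a "A x e" rule: linorder_cases) auto

lemma A_minus: "e < 1 \<Longrightarrow> A (- x) e = - A x e"
  using A_G[of e "- A x e"] by (simp add: G_minus G_A)

lemma A_add_1: "e < 1 \<Longrightarrow> A (x + 1) e = A x e + 1"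
  using A_G[of e "A x e + 1"] by (simp add: G_add_1 G_A)

lemma continuous_on_A_pair: "continuous_on (UNIV \<times> {..<1}) (\<lambda>z. A (fst z) (snd z))"
  unfolding continuous_on_def
proof
  fix z0 :: "real \<times> real" assume z0: "z0 \<in> UNIV \<times> {..<1}"
  have lim: "((\<lambda>z. fst z - G a (snd z)) \<longlongrightarrow> fst z0 - G a (snd z0)) (at z0 within UNIV \<times> {..<1})" for a
  proof -
    have "continuous_on (UNIV \<times> {..<1}) (\<lambda>z :: real \<times> real. fst z - G a (snd z))"
      unfolding G_def by (intro continuous_intros) (auto simp: F_neq_0)
    then show ?thesis using z0 unfolding continuous_on_def by blast
  qed
  have in_dom: "eventually (\<lambda>z. snd z < 1) (at z0 within UNIV \<times> {..<1})"
    unfolding eventually_at_filter by (rule always_eventually) auto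
  show "((\<lambda>z. A (fst z) (snd z)) \<longlongrightarrow> A (fst z0) (snd z0)) (at z0 within UNIV \<times> {..<1})"
  proof (rule order_tendstoI)
    fix a assume "a < A (fst z0) (snd z0)"
    then have "0 < fst z0 - G a (snd z0)" using z0 by (auto simp: less_A_iff)
    from order_tendstoD(1)[OF lim this] in_dom
    show "eventually (\<lambda>z. a < A (fst z) (snd z)) (at z0 within UNIV \<times> {..<1})"
      by eventually_elim (simp add: less_A_iff)
  next
    fix a assume "A (fst z0) (snd z0) < a"
    then have "fst z0 - G a (snd z0) < 0" using z0 by (auto simp: A_less_iff)
    from order_tendstoD(2)[OF lim this] in_dom
    show "eventually (\<lambda>z. A (fst z) (snd z) < a) (at z0 within UNIV \<times> {..<1})"
      by eventually_elim (simp add: A_less_iff)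
  qed
qed

lemma continuous_on_A [continuous_intros]:
  fixes X :: "'a::t2_space set"
  assumes "continuous_on X f" "continuous_on X g" "\<And>x. x \<in> X \<Longrightarrow> g x < 1"
  shows "continuous_on X (\<lambda>x. A (f x) (g x))"
  using continuous_on_compose2[OF continuous_on_A_pair continuous_on_Pair[OF assms(1,2)]] assms(3)
  by auto

text \<open>The map \<open>(a, e) \<mapsto> (G a e, e)\<close> has a triangular derivative, and \<open>(x, e) \<mapsto> (A x e, e)\<close> is its inverse.\<close>

lemma A_has_derivative:
  assumes e: "e < 1"
  shows "((\<lambda>(x, e). A x e) has_derivative
    (\<lambda>(dx, de). (dx - Ge (A x e) e * de) / Ga (A x e) e)) (at (x, e))"
proof -
  define a where "a = A x e"
  have Ga: "Ga a e \<noteq> 0" using Ga_pos[OF e, of a] by simp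
  have "((\<lambda>(x, e). (A x e, e)) has_derivative (\<lambda>(dx, de). ((dx - Ge a e * de) / Ga a e, de))) (at (x, e))"
  proof (rule has_derivative_inverse_basic[where f = "\<lambda>(a, e). (G a e, e)"
        and f' = "\<lambda>(da, de). (Ga a e * da + Ge a e * de, de)" and T = "UNIV \<times> {..<1}"])
    have "((\<lambda>z. ((\<lambda>(a, e). G a e) z, snd z)) has_derivative
        (\<lambda>z. ((\<lambda>(da, de). Ga a e * da + Ge a e * de) z, snd z))) (at (a, e))"
      by (intro has_derivative_Pair G_has_derivative e has_derivative_snd has_derivative_ident)
    then show "((\<lambda>(a, e). (G a e, e)) has_derivative (\<lambda>(da, de). (Ga a e * da + Ge a e * de, de)))
        (at ((\<lambda>(x, e). (A x e, e)) (x, e)))"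
      by (simp add: a_def case_prod_unfold)
    show "bounded_linear (\<lambda>(dx, de). ((dx - Ge a e * de) / Ga a e, de))"
      unfolding split_beta
      by (intro bounded_linear_Pair bounded_linear_divide[THEN bounded_linear_compose]
          bounded_linear_sub bounded_linear_fst bounded_linear_snd
          bounded_linear_mult_right[THEN bounded_linear_compose])
    show "(\<lambda>(dx, de). ((dx - Ge a e * de) / Ga a e, de)) \<circ> (\<lambda>(da, de). (Ga a e * da + Ge a e * de, de)) = id"
      using Ga by (auto simp: fun_eq_iff)
    have "continuous_on (UNIV \<times> {..<1}) (\<lambda>(x, e). (A x e, e))"
      unfolding split_beta by (intro continuous_intros) auto
    then show "continuous (at (x, e)) (\<lambda>(x, e). (A x e, e))"
      using e by (subst (asm) continuous_on_eq_continuous_at) (auto simp: open_Times)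
  qed (use e in \<open>auto simp: open_Times G_A\<close>)
  from has_derivative_fst[OF this] show ?thesis
    by (simp add: a_def case_prod_unfold)
qed

lemma A_deriv_space:
  assumes "e < 1"
  shows "((\<lambda>x. A x e) has_real_derivative 1 / Ga (A x e) e) (at x)"
proof -
  have "((\<lambda>x. (x, e)) has_derivative (\<lambda>d. (d, 0))) (at x)"
    by (auto intro!: derivative_eq_intros)
  from has_derivative_compose[OF this A_has_derivative[OF assms]] show ?thesis
    by (intro has_derivative_imp_has_field_derivative[where D = "\<lambda>d. d / Ga (A x e) e"]) simp_all
qed

lemma A_deriv_param:
  assumes "e < 1"
  shows "((\<lambda>e. A x e) has_real_derivative - Ge (A x e) e / Ga (A x e) e) (at e)"
proof -
  have "((\<lambda>e. (x, e)) has_derivative (\<lambda>d. (0, d))) (at e)"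
    by (auto intro!: derivative_eq_intros)
  from has_derivative_compose[OF this A_has_derivative[OF assms]] show ?thesis
    by (intro has_derivative_imp_has_field_derivative[where D = "\<lambda>d. - (Ge (A x e) e * d / Ga (A x e) e)"])
      simp_all
qed

end

section \<open>Velocity gradient and density along characteristics\<close>

context ghs_data
begin

text \<open>The rate of the time change: \<open>eta\<close> solves \<open>eta' = h eta\<close>.\<close>

definition h :: "real \<Rightarrow> real" where
  "h e = (1 + e / 2) * F e powr (- 2 * lam)"

text \<open>The factor of \<open>h e\<close> is the logarithmic derivative of the Jacobian \<open>Ga\<close> in \<open>e\<close>: the first term is local, the
second is its mean over the circle.\<close>

definition W :: "real \<Rightarrow> real \<Rightarrow> real" where
  "W a e = h e * (p * (bump a / dfac a e - Y e / F e))"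

definition R0 :: "real \<Rightarrow> real" where
  "R0 a = (1 + 2 * bump a) / (4 * sqrt (lam * kap))"

definition R :: "real \<Rightarrow> real \<Rightarrow> real" where
  "R a e = R0 a / dfac a e * F e powr (- 2 * lam)"

definition Wa :: "real \<Rightarrow> real \<Rightarrow> real" where
  "Wa a e = h e * p * (pi * sin (2 * pi * a)) / (dfac a e)\<^sup>2"

definition We :: "real \<Rightarrow> real \<Rightarrow> real" where
  "We a e = h e * p * ((1 / (2 + e) - Y e / F e) * (bump a / dfac a e - Y e / F e)
     + (bump a / dfac a e)\<^sup>2 - ((p + 1) * Z e / F e - p * (Y e / F e)\<^sup>2))"

definition Ra :: "real \<Rightarrow> real \<Rightarrow> real" where
  "Ra a e = pi * sin (2 * pi * a) * (2 / dfac a e + e * (1 + 2 * bump a) / (dfac a e)\<^sup>2)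
     / (4 * sqrt (lam * kap)) * F e powr (- 2 * lam)"

definition Re :: "real \<Rightarrow> real \<Rightarrow> real" where
  "Re a e = R a e * (bump a / dfac a e - Y e / F e)"

lemma h_pos: "- 1 < e \<Longrightarrow> e < 1 \<Longrightarrow> 0 < h e"
  using F_pos[of e] by (simp add: h_def)

lemma sqrt_lam_kap_pos: "0 < sqrt (lam * kap)"
  using lam_pos kap_pos by simp

lemma F_powr_deriv:
  assumes "e < 1"
  shows "((\<lambda>e. F e powr (- 2 * lam)) has_real_derivative - (Y e / F e) * F e powr (- 2 * lam)) (at e within S)"
proof -
  have "((\<lambda>e. F e powr (- 2 * lam)) has_real_derivative
      - 2 * lam * F e powr (- 2 * lam - 1) * (p * Y e)) (at e within S)"
    using F_deriv[OF assms, of S] F_pos[OF assms] by (auto intro!: derivative_eq_intros)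
  moreover have "- 2 * lam * F e powr (- 2 * lam - 1) * (p * Y e)
      = - (2 * lam * p) * (Y e / F e) * F e powr (- 2 * lam)"
    using F_pos[OF assms] by (simp add: powr_diff field_simps)
  ultimately show ?thesis by (simp add: two_lam_p)
qed

lemma h_deriv:
  assumes "- 2 < e" "e < 1"
  shows "(h has_real_derivative h e * (1 / (2 + e) - Y e / F e)) (at e within S)"
proof -
  have "(h has_real_derivative
      1 / 2 * F e powr (- 2 * lam) + (1 + e / 2) * (- (Y e / F e) * F e powr (- 2 * lam))) (at e within S)"
    unfolding h_def by (rule derivative_eq_intros F_powr_deriv[OF assms(2)] refl | simp)+
  moreover have "1 / 2 * F e powr (- 2 * lam) + (1 + e / 2) * (- (Y e / F e) * F e powr (- 2 * lam))
      = h e * (1 / (2 + e) - Y e / F e)"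
  proof -
    define c k L f where "c = 1 + e / 2" "k = 1 / (2 + e)" "L = Y e / F e" "f = F e powr (- 2 * lam)"
    have "c * f * (k - L) = c * k * f - c * L * f" by (simp add: algebra_simps)
    moreover have "c * k = 1 / 2" using assms by (simp add: c_k_L_f_def field_simps)
    ultimately show ?thesis
      unfolding h_def c_k_L_f_def[symmetric] by simp
  qed
  ultimately show ?thesis by simp
qed

lemma Y_over_F_deriv:
  assumes "e < 1"
  shows "((\<lambda>e. Y e / F e) has_real_derivative (p + 1) * Z e / F e - p * (Y e / F e)\<^sup>2) (at e within S)"
proof -
  have "((\<lambda>e. Y e / F e) has_real_derivative
      ((p + 1) * Z e * F e - Y e * (p * Y e)) / (F e * F e)) (at e within S)"
    using F_neq_0[OF assms] by (intro DERIV_divide F_deriv Y_deriv assms)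
  moreover have "((p + 1) * Z e * F e - Y e * (p * Y e)) / (F e * F e)
      = (p + 1) * Z e / F e - p * (Y e / F e)\<^sup>2"
    using F_neq_0[OF assms] by (simp add: field_simps power2_eq_square)
  ultimately show ?thesis by simp
qed

text \<open>Stated along an arbitrary curve so that it yields the partial derivatives in \<open>x\<close> and in \<open>t\<close> after
composition with the inverse of the characteristic map.\<close>

lemma W_curve_deriv:
  assumes a: "(a has_real_derivative a') (at s within S)"
    and e: "(e has_real_derivative e') (at s within S)" and es: "- 2 < e s" "e s < 1"
  shows "((\<lambda>s. W (a s) (e s)) has_real_derivative Wa (a s) (e s) * a' + We (a s) (e s) * e')
    (at s within S)"
proof -
  define T where "T = bump (a s) / dfac (a s) (e s)"
  define b where "b = pi * sin (2 * pi * a s)"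
  have D: "dfac (a s) (e s) \<noteq> 0" by (rule dfac_neq_0) fact
  note hd = DERIV_chain2[OF h_deriv[OF es, of UNIV] e]
  note rd = DERIV_chain2[OF Y_over_F_deriv[OF es(2), of UNIV] e]
  have Td: "((\<lambda>s. bump (a s) / dfac (a s) (e s)) has_real_derivative
      b * a' / (dfac (a s) (e s))\<^sup>2 + T\<^sup>2 * e') (at s within S)"
  proof -
    have "((\<lambda>s. bump (a s) / dfac (a s) (e s)) has_real_derivative
        (b * a' * dfac (a s) (e s) - bump (a s) * (- (e s * (b * a') + e' * bump (a s))))
          / (dfac (a s) (e s) * dfac (a s) (e s))) (at s within S)"
      using a e D unfolding dfac_def b_def
      by (intro DERIV_divide) (auto intro!: derivative_eq_intros)
    moreover have "(b * a' * dfac (a s) (e s) - bump (a s) * (- (e s * (b * a') + e' * bump (a s))))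
        = b * a' + (bump (a s))\<^sup>2 * e'"
      by (simp add: dfac_def power2_eq_square algebra_simps)
    ultimately show ?thesis
      by (simp add: T_def power_divide add_divide_distrib power2_eq_square)
  qed
  have "((\<lambda>s. W (a s) (e s)) has_real_derivative
      h (e s) * (1 / (2 + e s) - Y (e s) / F (e s)) * e' * (p * (T - Y (e s) / F (e s)))
      + (p * (b * a' / (dfac (a s) (e s))\<^sup>2 + T\<^sup>2 * e'
          - ((p + 1) * Z (e s) / F (e s) - p * (Y (e s) / F (e s))\<^sup>2) * e')) * h (e s)) (at s within S)"
    unfolding W_def T_def
    by (intro DERIV_mult DERIV_cmult DERIV_diff Td[unfolded T_def] hd rd) 
  then show ?thesis
    by (rule DERIV_cong) (simp add: Wa_def We_def T_def b_def algebra_simps)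
qed

lemma R_curve_deriv:
  assumes a: "(a has_real_derivative a') (at s within S)"
    and e: "(e has_real_derivative e') (at s within S)" and es: "e s < 1"
  shows "((\<lambda>s. R (a s) (e s)) has_real_derivative Ra (a s) (e s) * a' + Re (a s) (e s) * e')
    (at s within S)"
proof -
  define b where "b = pi * sin (2 * pi * a s)"
  define k where "k = 1 / (4 * sqrt (lam * kap))"
  have D: "dfac (a s) (e s) \<noteq> 0" by (rule dfac_neq_0) fact
  note fd = DERIV_chain2[OF F_powr_deriv[OF es, of UNIV] e]
  have R0d: "((\<lambda>s. R0 (a s)) has_real_derivative 2 * b * a' * k) (at s within S)"
  proof -
    have "R0 = (\<lambda>a. k * (1 + 2 * bump a))" by (simp add: R0_def k_def fun_eq_iff)
    then show ?thesis
      using a unfolding b_def by (auto intro!: derivative_eq_intros)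
  qed
  have Td: "((\<lambda>s. R0 (a s) / dfac (a s) (e s)) has_real_derivative
      (2 * b * a' * k * dfac (a s) (e s) - R0 (a s) * (- (e s * (b * a') + e' * bump (a s))))
          / (dfac (a s) (e s) * dfac (a s) (e s))) (at s within S)"
      using a e D R0d unfolding dfac_def b_def
      by (intro DERIV_divide) (auto intro!: derivative_eq_intros)
  have der: "((\<lambda>s. R (a s) (e s)) has_real_derivative
      (2 * b * a' * k * dfac (a s) (e s) - R0 (a s) * (- (e s * (b * a') + e' * bump (a s))))
          / (dfac (a s) (e s) * dfac (a s) (e s)) * F (e s) powr (- 2 * lam)
      + (- (Y (e s) / F (e s)) * F (e s) powr (- 2 * lam) * e') * (R0 (a s) / dfac (a s) (e s)))
      (at s within S)"
    unfolding R_def by (intro DERIV_mult Td fd) 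
  have R0: "R0 (a s) = k * (1 + 2 * bump (a s))" by (simp add: R0_def k_def)
  have Ra: "Ra (a s) (e s) = b * k * (2 / dfac (a s) (e s)
      + e s * (1 + 2 * bump (a s)) / (dfac (a s) (e s))\<^sup>2) * F (e s) powr (- 2 * lam)"
    by (simp add: Ra_def b_def k_def)
  have alg: "(2 * b * a' * k * d - k * (1 + 2 * B) * (- (q * (b * a') + e' * B))) / (d * d) * f
      + (- L * f * e') * (k * (1 + 2 * B) / d)
      = b * k * (2 / d + q * (1 + 2 * B) / d\<^sup>2) * f * a' + k * (1 + 2 * B) / d * f * (B / d - L) * e'"
    if "d \<noteq> 0" for d B L f q :: real
    using that by (simp add: field_simps power2_eq_square)
  from der[unfolded R0 alg[OF D]] show ?thesis
    by (simp only: Ra Re_def R_def R0)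
qed

lemma continuous_on_h [continuous_intros]:
  fixes X :: "'a::t2_space set"
  assumes "continuous_on X g" "\<And>x. x \<in> X \<Longrightarrow> g x < 1"
  shows "continuous_on X (\<lambda>x. h (g x))"
  unfolding h_def using assms F_neq_0 by (intro continuous_intros) auto

lemma continuous_on_profiles [continuous_intros]:
  fixes X :: "'a::t2_space set"
  assumes "continuous_on X f" "continuous_on X g" "\<And>x. x \<in> X \<Longrightarrow> - 2 < g x" "\<And>x. x \<in> X \<Longrightarrow> g x < 1"
  shows "continuous_on X (\<lambda>x. W (f x) (g x))" "continuous_on X (\<lambda>x. R (f x) (g x))"
    "continuous_on X (\<lambda>x. Wa (f x) (g x))" "continuous_on X (\<lambda>x. We (f x) (g x))"
    "continuous_on X (\<lambda>x. Ra (f x) (g x))" "continuous_on X (\<lambda>x. Re (f x) (g x))"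
proof -
  have neq: "dfac (f x) (g x) \<noteq> 0" "F (g x) \<noteq> 0" "2 + g x \<noteq> 0" "sqrt (lam * kap) \<noteq> 0" if "x \<in> X" for x
    using assms(3,4)[OF that] F_neq_0 dfac_neq_0 sqrt_lam_kap_pos by auto
  note [continuous_intros] = assms(1,2)
  show "continuous_on X (\<lambda>x. W (f x) (g x))" 
    unfolding W_def using assms(4) neq by (intro continuous_intros) auto
  show R: "continuous_on X (\<lambda>x. R (f x) (g x))"
    unfolding R_def R0_def using assms(4) neq by (intro continuous_intros) auto
  show "continuous_on X (\<lambda>x. Wa (f x) (g x))"
    unfolding Wa_def using assms(4) neq by (intro continuous_intros) auto
  show "continuous_on X (\<lambda>x. We (f x) (g x))"
    unfolding We_def using assms(4) neq by (intro continuous_intros) auto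
  show "continuous_on X (\<lambda>x. Ra (f x) (g x))"
    unfolding Ra_def using assms(4) neq by (intro continuous_intros) auto
  show "continuous_on X (\<lambda>x. Re (f x) (g x))"
    unfolding Re_def using assms(4) neq by (intro continuous_intros R) auto
qed

text \<open>The common value of the left-hand side of the first equation at all labels.\<close>

definition source :: "real \<Rightarrow> real" where
  "source e = (h e)\<^sup>2 * ((lam + 1) * (p * (Y e / F e))\<^sup>2 - p * (p + 1) * Z e / F e
     - p * (Y e / F e) / (2 + e) - 1 / (4 * lam * (2 + e)\<^sup>2))"

text \<open>The density is chosen so that \<open>1 + 2 * bump a\<close> is \<open>(2 + e) * bump a + dfac a e\<close>, a combination with coefficients
independent of the label; this is the square that \<open>reduced_equation\<close> needs.\<close>

lemma kap_R_square:
  assumes "- 1 < e" "e < 1"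
  shows "kap * (R a e)\<^sup>2 = (h e)\<^sup>2 / (4 * lam) * (bump a / dfac a e + 1 / (2 + e))\<^sup>2"
proof -
  define f where "f = F e powr (- 2 * lam)"
  have D: "dfac a e \<noteq> 0" using assms by (intro dfac_neq_0)
  have k: "2 + e \<noteq> 0" using assms by simp
  have "kap * (R a e)\<^sup>2 = kap * ((1 + 2 * bump a)\<^sup>2 / (16 * (sqrt (lam * kap))\<^sup>2) / (dfac a e)\<^sup>2 * f\<^sup>2)"
    by (simp add: R_def R0_def f_def power_divide power_mult_distrib)
  also have "\<dots> = (1 + 2 * bump a)\<^sup>2 / (dfac a e)\<^sup>2 * f\<^sup>2 / (16 * lam)"
    using lam_pos kap_pos by (simp add: field_simps)
  also have "1 + 2 * bump a = dfac a e * ((bump a / dfac a e + 1 / (2 + e)) * (2 + e))"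
  proof -
    have "d * ((B / d + 1 / c) * c) = B * c + d" if "d \<noteq> 0" "c \<noteq> 0" for d B c :: real
      using that by (simp add: field_simps)
    from this[OF D k] have eq: "dfac a e * ((bump a / dfac a e + 1 / (2 + e)) * (2 + e)) = bump a * (2 + e) + dfac a e" .
    show ?thesis
      unfolding eq by (simp add: dfac_def algebra_simps)
  qed
  also have "(\<dots>)\<^sup>2 / (dfac a e)\<^sup>2 * f\<^sup>2 / (16 * lam)
      = ((2 + e) * f)\<^sup>2 * (bump a / dfac a e + 1 / (2 + e))\<^sup>2 / (16 * lam)"
    using D by (simp add: power_mult_distrib)
  also have "(2 + e) * f = 2 * h e" by (simp add: h_def f_def field_simps)
  finally show ?thesis by (simp add: power_mult_distrib)
qed

text \<open>With \<open>T = bump a / dfac a e\<close> and \<open>k = 1 / (2 + e)\<close> the label enters only through a multiple of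
\<open>T\<^sup>2 + 2 * k * T\<close>, and \<open>kap_R_square\<close> subtracts the same multiple of \<open>(T + k)\<^sup>2\<close>.\<close>

lemma reduced_equation:
  assumes "- 1 < e" "e < 1"
  shows "h e * We a e - lam * (W a e)\<^sup>2 - kap * (R a e)\<^sup>2 = source e"
proof -
  define T where "T = bump a / dfac a e"
  define L where "L = Y e / F e"
  define z where "z = Z e / F e"
  define k where "k = 1 / (2 + e)"
  have l1: "lam * p\<^sup>2 = p / 2" using lam_pos by (simp add: p_def power2_eq_square)
  have l2: "x / (4 * lam) = p / 2 * x" for x by (simp add: p_def)
  have l3: "(lam + 1) * (p * L)\<^sup>2 = p / 2 * L\<^sup>2 + p\<^sup>2 * L\<^sup>2"
    unfolding l1[symmetric] by (simp add: power_mult_distrib distrib_right)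
  have "h e * We a e - lam * (W a e)\<^sup>2 - kap * (R a e)\<^sup>2
      = (h e)\<^sup>2 * (p * ((k - L) * (T - L) + T\<^sup>2 - ((p + 1) * z - p * L\<^sup>2))
          - lam * p\<^sup>2 * (T - L)\<^sup>2 - (T + k)\<^sup>2 / (4 * lam))"
    unfolding kap_R_square[OF assms] We_def W_def T_def[symmetric] L_def[symmetric]
      k_def[symmetric] times_divide_eq_right[symmetric] z_def[symmetric]
    by (simp add: power2_eq_square algebra_simps add_divide_distrib)
  also have "\<dots> = (h e)\<^sup>2 * ((lam + 1) * (p * L)\<^sup>2 - p * (p + 1) * z - p * L * k - k\<^sup>2 / (4 * lam))"
    unfolding l1 l2 l3 by (simp add: power2_eq_square algebra_simps add_divide_distrib diff_divide_distrib)
  also have "\<dots> = source e"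
    by (simp add: source_def L_def z_def k_def power_divide)
  finally show ?thesis .
qed

text \<open>The logarithmic derivative of \<open>R\<close> in \<open>e\<close> is that of the Jacobian \<open>Ga\<close>, multiplied by \<open>2 * lam = 1 / p\<close>.\<close>

lemma R_transport: "h e * Re a e = 2 * lam * R a e * W a e"
proof -
  have "2 * lam * R a e * W a e = (2 * lam * p) * (h e * Re a e)"
    by (simp add: Re_def W_def)
  then show ?thesis by (simp add: two_lam_p)
qed

end

section \<open>Asymptotics at the critical value of eta\<close>

lemma minus_ln_at_left_1: "filterlim (\<lambda>e::real. - ln (1 - e)) at_top (at_left 1)"
proof -
  have "filterlim (\<lambda>e::real. 1 - e) (at_right 0) (at_left 1)"
  proof (subst filterlim_at, intro conjI)
    show "eventually (\<lambda>e::real. 1 - e \<in> {0<..} \<and> 1 - e \<noteq> 0) (at_left 1)"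
      by (rule eventually_at_leftI[of 0]) auto
    have "((\<lambda>e::real. 1 - e) \<longlongrightarrow> 1 - 1) (at_left 1)" by (intro tendsto_intros)
    then show "((\<lambda>e::real. 1 - e) \<longlongrightarrow> 0) (at_left 1)" by simp
  qed
  from filterlim_compose[OF ln_at_0 this]
  show ?thesis
    by (simp add: filterlim_uminus_at_bot)
qed

lemma powr_at_left_1:
  fixes c s :: real
  assumes "0 < c" "0 < s"
  shows "filterlim (\<lambda>e. c * (1 - e) powr (- s)) at_top (at_left 1)"
proof -
  from filterlim_tendsto_pos_mult_at_top[OF tendsto_const assms(2) minus_ln_at_left_1]
  have "filterlim (\<lambda>e::real. c * exp (s * - ln (1 - e))) at_top (at_left 1)"
    by (intro filterlim_tendsto_pos_mult_at_top[OF tendsto_const assms(1)]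
        filterlim_compose[OF exp_at_top])
  moreover have "eventually (\<lambda>e::real. c * exp (s * - ln (1 - e)) = c * (1 - e) powr (- s)) (at_left 1)"
    by (rule eventually_at_leftI[of 0]) (auto simp: powr_def)
  ultimately show ?thesis
    using filterlim_cong[OF refl refl] by fast
qed

context ghs_data
begin

lemma two_lam_m: "2 * lam * m = 1 - 1 / r"
proof -
  have "2 * lam * m = (2 * lam * p) * (1 - 1 / r)" unfolding m_def by (simp only: mult.assoc)
  then show ?thesis by (simp only: two_lam_p mult_1)
qed

lemma F_powr_lower:
  assumes "0 \<le> q"
  obtains c where "0 < c" "\<And>e. 1 / 2 \<le> e \<Longrightarrow> e < 1 \<Longrightarrow> c * (1 - e) powr (m * q) \<le> F e powr (- q)"
proof -
  obtain K where K: "0 < K" "\<And>e. 1 / 2 \<le> e \<Longrightarrow> e < 1 \<Longrightarrow> F e \<le> K * (1 - e) powr (- m)"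
    by (rule F_growth) (rule that)
  show ?thesis
  proof
    show "0 < K powr (- q)" using K by simp
    fix e :: real assume e: "1 / 2 \<le> e" "e < 1"
    have "(K * (1 - e) powr (- m)) powr (- q) \<le> F e powr (- q)"
      using K(2)[OF e] F_pos[OF e(2)] assms by (intro powr_mono2') auto
    then show "K powr (- q) * (1 - e) powr (m * q) \<le> F e powr (- q)"
      using K(1) by (simp add: powr_mult powr_powr)
  qed
qed

lemma F_powr_le_h: "0 \<le> e \<Longrightarrow> F e powr (- 2 * lam) \<le> h e"
  unfolding h_def by (simp add: mult_le_cancel_right1)

lemma F_powr_growth:
  obtains c where "0 < c"
    "\<And>e. 1 / 2 \<le> e \<Longrightarrow> e < 1 \<Longrightarrow> c * (1 - e) powr (1 - 1 / r) \<le> F e powr (- 2 * lam)"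
proof -
  have "0 \<le> 2 * lam" using lam_pos by simp
  from F_powr_lower[OF this] obtain c where c: "0 < c"
    "\<And>e. 1 / 2 \<le> e \<Longrightarrow> e < 1 \<Longrightarrow> c * (1 - e) powr (m * (2 * lam)) \<le> F e powr (- (2 * lam))"
    by blast
  have "m * (2 * lam) = 1 - 1 / r" using two_lam_m by (simp only: mult.commute)
  with c show ?thesis by (intro that[of c]) simp_all
qed

text \<open>For \<open>p \<ge> 1 / 2\<close> the lower bound for \<open>Y\<close> makes \<open>F'\<close> at least a multiple of \<open>1 / (1 - e)\<close>.\<close>

lemma F_at_top:
  assumes "lam \<le> 1"
  shows "filterlim F at_top (at_left 1)"
proof -
  have p: "1 / 2 \<le> p" using assms lam_pos by (simp add: p_def field_simps)
  obtain c where c: "0 < c"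
    "\<And>e. 31 / 32 \<le> e \<Longrightarrow> e < 1 \<Longrightarrow> c * (1 - e) powr (- (p + 1 / 2)) \<le> Y e"
    by (rule Y_growth) (rule that)
  define e0 :: real where "e0 = 31 / 32"
  have lower: "F e0 + p * c * ln (1 - e0) - p * c * ln (1 - e) \<le> F e" if e: "e0 \<le> e" "e < 1" for e
  proof -
    have "F e0 + p * c * ln (1 - e0) \<le> F e + p * c * ln (1 - e)"
    proof (rule DERIV_nonneg_imp_nondecreasing[OF e(1)])
      fix x assume x: "e0 \<le> x" "x \<le> e"
      then have x1: "x < 1" "0 < 1 - x" "1 - x \<le> 1" using e by (auto simp: e0_def)
      have der: "((\<lambda>x. F x + p * c * ln (1 - x)) has_real_derivative p * Y x - p * c / (1 - x)) (at x)"
        using x1 by (auto intro!: derivative_eq_intros F_deriv)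
      have "1 / (1 - x) \<le> (1 - x) powr (- (p + 1 / 2))"
      proof -
        have "(1 - x) powr - 1 \<le> (1 - x) powr (- (p + 1 / 2))"
          using p x1 by (intro powr_mono') auto
        then show ?thesis using x1 by (simp only: powr_neg_one)
      qed
      then have "c * (1 / (1 - x)) \<le> c * (1 - x) powr (- (p + 1 / 2))"
        using c(1) by (intro mult_left_mono) simp_all
      also have "\<dots> \<le> Y x" using c(2)[of x] x x1 by (simp add: e0_def)
      finally have "c * (1 / (1 - x)) \<le> Y x" .
      then have "0 \<le> p * (Y x - c * (1 / (1 - x)))"
        using p_pos by (intro mult_nonneg_nonneg) auto
      then have "0 \<le> p * Y x - p * c / (1 - x)"
        by (simp add: right_diff_distrib)
      with der show "\<exists>y. ((\<lambda>x. F x + p * c * ln (1 - x)) has_real_derivative y) (at x) \<and> 0 \<le> y"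
        by blast
    qed
    then show ?thesis by simp
  qed
  have "filterlim (\<lambda>e::real. (F e0 + p * c * ln (1 - e0)) + p * c * - ln (1 - e)) at_top (at_left 1)"
    using p_pos c(1)
    by (intro filterlim_tendsto_add_at_top[OF tendsto_const]
        filterlim_tendsto_pos_mult_at_top[OF tendsto_const _ minus_ln_at_left_1]) auto
  then show ?thesis
    by (rule filterlim_at_top_mono) (use lower in \<open>auto intro!: eventually_at_leftI[of e0] simp: e0_def\<close>)
qed

text \<open>For \<open>2 * p < 1\<close> the inequality \<open>F \<le> 1 + 2 * p * X \<le> 1 + 2 * p * F\<close> bounds \<open>F\<close>, which is increasing.\<close>

lemma F_tendsto:
  assumes "1 < lam"
  obtains L where "0 < L" "(F \<longlongrightarrow> L) (at_left 1)"
proof -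
  have p: "0 < 1 - 2 * p" using assms by (simp add: p_def field_simps)
  have bound: "F e \<le> 1 / (1 - 2 * p)" if e: "0 \<le> e" "e < 1" for e
  proof -
    have "X e \<le> F e" using Y_nonneg[OF e(2)] e by (simp add: X_def)
    then have "F e \<le> 1 + 2 * p * F e"
      using F_le_X[OF e] p_pos by (smt (verit) mult_left_mono)
    then show ?thesis using p by (simp add: pos_le_divide_eq algebra_simps)
  qed
  have mono: "F x \<le> F y" if "x \<le> y" "y < 1" for x y
  proof (rule DERIV_nonneg_imp_nondecreasing[OF that(1)])
    fix z assume "x \<le> z" "z \<le> y"
    then have "z < 1" using that by simp
    then show "\<exists>d. (F has_real_derivative d) (at z) \<and> 0 \<le> d"
      using F_deriv[of z UNIV] Y_nonneg[of z] p_pos by (intro exI[of _ "p * Y z"]) simp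
  qed
  have bdd: "bdd_above (F ` {0..<1})"
    using bound by (intro bdd_aboveI2[of _ _ "1 / (1 - 2 * p)"]) auto
  define L where "L = (SUP e\<in>{0..<1}. F e)"
  have le: "F e \<le> L" if "0 \<le> e" "e < 1" for e
    unfolding L_def using that by (intro cSUP_upper bdd) auto
  show ?thesis
  proof
    show "0 < L" using le[of 0] F_pos[of 0] by simp
    show "(F \<longlongrightarrow> L) (at_left 1)"
    proof (rule increasing_tendsto)
      show "eventually (\<lambda>e. F e \<le> L) (at_left 1)"
        using le by (auto intro!: eventually_at_leftI[of 0])
      fix x assume "x < L"
      then obtain e where e: "e \<in> {0..<1}" "x < F e"
        unfolding L_def using less_cSUP_iff[OF _ bdd] by auto
      then show "eventually (\<lambda>e. x < F e) (at_left 1)"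
        using mono by (intro eventually_at_leftI[of e]) (auto intro: less_le_trans)
    qed
  qed
qed

lemma at_peak: "bump (1 / 2) = 1" "dfac (1 / 2) e = 1 - e"
  by (simp_all add: bump_def dfac_def)

text \<open>The difference between the local and the mean term is the fraction \<open>X e / F e \<ge> 1 / r\<close> of the local term, and
\<open>h\<close> decays more slowly than \<open>1 - e\<close>.\<close>

lemma W_peak: "filterlim (W (1 / 2)) at_top (at_left 1)"
proof -
  obtain c where c: "0 < c"
    "\<And>e. 1 / 2 \<le> e \<Longrightarrow> e < 1 \<Longrightarrow> c * (1 - e) powr (1 - 1 / r) \<le> F e powr (- 2 * lam)"
    by (rule F_powr_growth) (rule that)
  have "c * p / r * (1 - e) powr (- (1 / r)) \<le> W (1 / 2) e" if e: "1 / 2 \<le> e" "e < 1" for e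
  proof -
    have "1 / r \<le> X e / F e"
      using F_le_r_X[OF e] F_pos[OF e(2)] r_bounds by (simp add: field_simps)
    moreover have "c * (1 - e) powr (1 - 1 / r) \<le> h e"
      using c(2)[OF e] F_powr_le_h[of e] e by simp
    ultimately have "c * (1 - e) powr (1 - 1 / r) * (p * (1 / r / (1 - e))) \<le> h e * (p * (X e / F e / (1 - e)))"
      using e p_pos c(1) r_bounds h_pos[of e] by (intro mult_mono mult_left_mono divide_right_mono) auto
    also have "X e / F e / (1 - e) = 1 / (1 - e) - Y e / F e"
      using e F_neq_0[OF e(2)] by (simp add: X_def diff_divide_distrib)
    also have "h e * (p * \<dots>) = W (1 / 2) e"
      by (simp add: W_def at_peak)
    also have "c * (1 - e) powr (1 - 1 / r) * (p * (1 / r / (1 - e))) = c * p / r * (1 - e) powr (- (1 / r))"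
      using e powr_add[of "1 - e" 1 "- (1 / r)"] by simp
    finally show ?thesis .
  qed
  then show ?thesis
    using c(1) p_pos r_bounds
    by (intro filterlim_at_top_mono[OF powr_at_left_1[of "c * p / r" "1 / r"]])
      (auto intro!: eventually_at_leftI[of "1 / 2"])
qed

lemma R0_pos: "0 < R0 a"
  using bump_bounds[of a] sqrt_lam_kap_pos by (auto simp: R0_def intro!: divide_pos_pos)

lemma R_peak: "filterlim (R (1 / 2)) at_top (at_left 1)"
proof -
  obtain c where c: "0 < c"
    "\<And>e. 1 / 2 \<le> e \<Longrightarrow> e < 1 \<Longrightarrow> c * (1 - e) powr (1 - 1 / r) \<le> F e powr (- 2 * lam)"
    by (rule F_powr_growth) (rule that)
  have "R0 (1 / 2) * c * (1 - e) powr (- (1 / r)) \<le> R (1 / 2) e" if e: "1 / 2 \<le> e" "e < 1" for e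
  proof -
    have "R0 (1 / 2) * c * (1 - e) powr (- (1 / r)) = R0 (1 / 2) / (1 - e) * (c * (1 - e) powr (1 - 1 / r))"
      using e by (simp add: powr_diff powr_minus field_simps)
    also have "\<dots> \<le> R0 (1 / 2) / (1 - e) * F e powr (- 2 * lam)"
      using c(2)[OF e] e R0_pos[of "1 / 2"] by (intro mult_left_mono) auto
    finally show ?thesis by (simp add: R_def at_peak)
  qed
  then show ?thesis
    using c(1) R0_pos[of "1 / 2"] r_bounds
    by (intro filterlim_at_top_mono[OF powr_at_left_1[of "R0 (1 / 2) * c" "1 / r"]])
      (auto intro!: eventually_at_leftI[of "1 / 2"])
qed

text \<open>The exponents of the lower bound for \<open>Y\<close> and of the upper bound for \<open>F\<close> add up to
\<open>1 / 2 - (p + 1) / r\<close>, which is negative exactly because \<open>r < 2 * (p + 1)\<close>.\<close>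

lemma h_ratio_at_top: "filterlim (\<lambda>e. h e * (Y e / F e)) at_top (at_left 1)"
proof -
  obtain c where c: "0 < c"
    "\<And>e. 31 / 32 \<le> e \<Longrightarrow> e < 1 \<Longrightarrow> c * (1 - e) powr (- (p + 1 / 2)) \<le> Y e"
    by (rule Y_growth) (rule that)
  have "0 \<le> 2 * lam + 1" using lam_pos by simp
  from F_powr_lower[OF this] obtain d where d: "0 < d"
    "\<And>e. 1 / 2 \<le> e \<Longrightarrow> e < 1 \<Longrightarrow> d * (1 - e) powr (m * (2 * lam + 1)) \<le> F e powr (- (2 * lam + 1))"
    by blast
  have "m * (2 * lam + 1) = 2 * lam * m + m" by (simp add: algebra_simps)
  also have "\<dots> = (p + 1) * (1 - 1 / r)" unfolding two_lam_m by (simp add: m_def algebra_simps add_divide_distrib)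
  finally have m: "m * (2 * lam + 1) = (p + 1) * (1 - 1 / r)" .
  define s where "s = (p + 1) / r - 1 / 2"
  have s: "0 < s" using r_bounds by (simp add: s_def field_simps)
  have "c * d * (1 - e) powr (- s) \<le> h e * (Y e / F e)" if e: "31 / 32 \<le> e" "e < 1" for e
  proof -
    have "- s = - (p + 1 / 2) + m * (2 * lam + 1)"
      unfolding m s_def by (simp add: algebra_simps)
    then have "c * d * (1 - e) powr (- s)
        = (c * (1 - e) powr (- (p + 1 / 2))) * (d * (1 - e) powr (m * (2 * lam + 1)))"
      by (simp only: powr_add mult_ac)
    also have "\<dots> \<le> Y e * F e powr (- (2 * lam + 1))"
      using c(2)[OF e] d(2)[of e] e Y_nonneg[OF e(2)] d(1) by (intro mult_mono) auto
    also have "\<dots> = F e powr (- 2 * lam) * (Y e / F e)"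
      using F_pos[OF e(2)] powr_diff[of "F e" "- 2 * lam" 1] by (simp add: mult.commute)
    also have "\<dots> \<le> h e * (Y e / F e)"
      using F_powr_le_h[of e] F_pos[OF e(2)] Y_nonneg[OF e(2)] e by (intro mult_right_mono) auto
    finally show ?thesis .
  qed
  then show ?thesis
    using c(1) d(1) s
    by (intro filterlim_at_top_mono[OF powr_at_left_1[of "c * d" s]])
      (auto intro!: eventually_at_leftI[of "31 / 32"])
qed

lemma W_off_peak:
  assumes "bump a < 1"
  shows "filterlim (W a) at_bot (at_left 1)"
proof -
  define B where "B = 3 / 2 * (p * (1 / (1 - bump a)))"
  have le: "- B + p * (h e * (Y e / F e)) \<le> - W a e" if e: "0 \<le> e" "e < 1" for e
  proof -
    have "F e powr (- 2 * lam) \<le> 1"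
      using F_ge_1[OF e] lam_pos powr_mono2'[of "- 2 * lam" 1 "F e"] by simp
    then have h: "h e \<le> 3 / 2"
      using e mult_mono[of "1 + e / 2" "3 / 2" "F e powr (- 2 * lam)" 1] by (simp add: h_def)
    have "1 - bump a \<le> dfac a e"
      using e bump_bounds[of a] mult_left_le_one_le[of "bump a" e] by (simp add: dfac_def)
    then have "bump a / dfac a e \<le> 1 / (1 - bump a)"
      using assms bump_bounds[of a] by (intro frac_le) auto
    then have "h e * (p * (bump a / dfac a e)) \<le> B"
      unfolding B_def using h h_pos[of e] e p_pos bump_bounds[of a] dfac_pos[OF e(2), of a]
      by (intro mult_mono mult_left_mono) auto
    moreover have "W a e = h e * (p * (bump a / dfac a e)) - p * (h e * (Y e / F e))"
      by (simp add: W_def algebra_simps)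
    ultimately show ?thesis by simp
  qed
  have "filterlim (\<lambda>e. - B + p * (h e * (Y e / F e))) at_top (at_left 1)"
    using p_pos h_ratio_at_top
    by (intro filterlim_tendsto_add_at_top[OF tendsto_const] filterlim_tendsto_pos_mult_at_top[OF tendsto_const])
  then have "filterlim (\<lambda>e. - W a e) at_top (at_left 1)"
    by (rule filterlim_at_top_mono) (use le in \<open>auto intro!: eventually_at_leftI[of 0]\<close>)
  then show ?thesis by (simp add: filterlim_uminus_at_bot)
qed

lemma R_off_peak_tendsto:
  assumes "bump a < 1" "((\<lambda>e. F e powr (- 2 * lam)) \<longlongrightarrow> l) (at_left 1)"
  shows "(R a \<longlongrightarrow> R0 a / (1 - bump a) * l) (at_left 1)"
proof -
  have "(dfac a \<longlongrightarrow> 1 - 1 * bump a) (at_left 1)"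
    unfolding dfac_def by (intro tendsto_intros)
  then show ?thesis
    unfolding R_def using assms by (intro tendsto_intros) auto
qed

lemma R_off_peak_le_1:
  assumes "bump a < 1" "lam \<le> 1"
  shows "(R a \<longlongrightarrow> 0) (at_left 1)"
  using R_off_peak_tendsto[OF assms(1) tendsto_neg_powr[OF _ F_at_top[OF assms(2)]]] lam_pos by simp

lemma R_off_peak_gt_1:
  assumes "bump a < 1" "1 < lam"
  shows "\<exists>l. l \<noteq> 0 \<and> (R a \<longlongrightarrow> l) (at_left 1)"
proof -
  obtain L where L: "0 < L" "(F \<longlongrightarrow> L) (at_left 1)" using F_tendsto[OF assms(2)] .
  have "((\<lambda>e. F e powr (- 2 * lam)) \<longlongrightarrow> L powr (- 2 * lam)) (at_left 1)"
    using L by (intro tendsto_powr tendsto_const) auto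
  from R_off_peak_tendsto[OF assms(1) this] show ?thesis
    using L(1) R0_pos[of a] assms(1) by (intro exI[of _ "R0 a / (1 - bump a) * L powr (- 2 * lam)"]) auto
qed

end

section \<open>The nonlocal term and the time variable\<close>

context ghs_data
begin

lemma integral_over_positions:
  assumes e: "e < 1" and K: "continuous_on UNIV K"
  shows "((\<lambda>a. Ga a e * K a) has_integral integral {0..1} (\<lambda>x. K (A x e))) {0..1}"
proof -
  have "continuous_on {0..1} (\<lambda>x. K (A x e))"
    using e by (intro continuous_on_compose2[OF K] continuous_intros) auto
  then have "((\<lambda>a. Ga a e *\<^sub>R K (A (G a e) e)) has_integral
      integral {G 0 e..G 1 e} (\<lambda>x. K (A x e))) {0..1}"
    using G_strict_mono[OF e, of 0] G_strict_mono[OF e, of _ 1] G_0[of e] G_add_1[OF e, of 0]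
    by (intro has_integral_substitution[where c = 0 and d = 1] G_deriv_space e)
      (auto simp: less_eq_real_def)
  then show ?thesis
    using G_0[of e] G_add_1[OF e, of 0] by (simp add: A_G[OF e])
qed

text \<open>Multiplication by \<open>bump a / dfac a e\<close> raises both indices of the kernel by one, so each such
integral is a combination of three moments.\<close>

lemma shifted_square_moment:
  assumes e: "e < 1"
  shows "((\<lambda>a. Ga a e * (bump a / dfac a e + c)\<^sup>2) has_integral
    Z e / F e + 2 * c * (Y e / F e) + c\<^sup>2) {0..1}"
proof -
  have "((\<lambda>a. (kern 2 (p + 2) a e + 2 * c * kern 1 (p + 1) a e + c\<^sup>2 * kern 0 p a e) / F e)
      has_integral (Z e + 2 * c * Y e + c\<^sup>2 * F e) / F e) {0..1}"
    unfolding Z_def Y_def F_def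
    by (intro has_integral_divide has_integral_add has_integral_mult_right kern_has_integral e)
  moreover have "(Z e + 2 * c * Y e + c\<^sup>2 * F e) / F e = Z e / F e + 2 * c * (Y e / F e) + c\<^sup>2"
    using F_neq_0[OF e] by (simp add: field_simps)
  moreover have "(kern 2 (p + 2) a e + 2 * c * kern 1 (p + 1) a e + c\<^sup>2 * kern 0 p a e) / F e
      = Ga a e * (bump a / dfac a e + c)\<^sup>2" for a
  proof -
    have k1: "kern 1 (p + 1) a e = kern 0 p a e * (bump a / dfac a e)"
      using kern_Suc_eq[OF e, of 0 p a] by simp
    have k2: "kern 2 (p + 2) a e = kern 0 p a e * (bump a / dfac a e) * (bump a / dfac a e)"
      using kern_Suc_eq[OF e, of 1 "p + 1" a] k1 by (simp add: numeral_2_eq_2 add.assoc)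
    show ?thesis
      unfolding k1 k2 Ga_def by (simp add: power2_eq_square algebra_simps add_divide_distrib)
  qed
  ultimately show ?thesis by simp
qed

text \<open>All integrals reduce to \<open>F\<close>, \<open>Y\<close> and \<open>Z\<close>.  The coefficient of \<open>Z\<close> agrees on both sides because
\<open>lam * p\<^sup>2 = p / 2\<close>.\<close>

lemma source_eq:
  assumes e: "- 1 < e" "e < 1"
  shows "source e = - kap * integral {0..1} (\<lambda>x. (R (A x e) e)\<^sup>2)
    - (1 + lam) * integral {0..1} (\<lambda>x. (W (A x e) e)\<^sup>2)"
proof -
  define L z k where "L = Y e / F e" "z = Z e / F e" "k = 1 / (2 + e)"
  have "((\<lambda>a. (h e * p)\<^sup>2 * (Ga a e * (bump a / dfac a e + - L)\<^sup>2)) has_integral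
      (h e * p)\<^sup>2 * (Z e / F e + 2 * - L * (Y e / F e) + (- L)\<^sup>2)) {0..1}"
    by (intro has_integral_mult_right shifted_square_moment e)
  moreover have "(h e * p)\<^sup>2 * (Ga a e * (bump a / dfac a e + - L)\<^sup>2) = Ga a e * (W a e)\<^sup>2" for a
    by (simp add: W_def L_z_k_def power_mult_distrib)
  ultimately have "((\<lambda>a. Ga a e * (W a e)\<^sup>2) has_integral
      (h e * p)\<^sup>2 * (Z e / F e + 2 * - L * (Y e / F e) + (- L)\<^sup>2)) {0..1}"
    by (simp only:)
  moreover have "((\<lambda>a. Ga a e * (W a e)\<^sup>2) has_integral integral {0..1} (\<lambda>x. (W (A x e) e)\<^sup>2)) {0..1}"
    using e by (intro integral_over_positions continuous_intros) auto
  ultimately have IW: "integral {0..1} (\<lambda>x. (W (A x e) e)\<^sup>2)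
      = (h e * p)\<^sup>2 * (Z e / F e + 2 * - L * (Y e / F e) + (- L)\<^sup>2)"
    by (rule has_integral_unique[symmetric])
  have "((\<lambda>a. (h e)\<^sup>2 / (4 * lam) * (Ga a e * (bump a / dfac a e + k)\<^sup>2)) has_integral
      (h e)\<^sup>2 / (4 * lam) * (Z e / F e + 2 * k * (Y e / F e) + k\<^sup>2)) {0..1}"
    by (intro has_integral_mult_right shifted_square_moment e)
  moreover have "(h e)\<^sup>2 / (4 * lam) * (Ga a e * (bump a / dfac a e + k)\<^sup>2) = kap * (Ga a e * (R a e)\<^sup>2)" for a
    using kap_R_square[OF e, of a] by (simp add: L_z_k_def mult.left_commute[of kap])
  ultimately have "((\<lambda>a. kap * (Ga a e * (R a e)\<^sup>2)) has_integral
      (h e)\<^sup>2 / (4 * lam) * (Z e / F e + 2 * k * (Y e / F e) + k\<^sup>2)) {0..1}"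
    by (simp only:)
  moreover have "((\<lambda>a. kap * (Ga a e * (R a e)\<^sup>2)) has_integral
      kap * integral {0..1} (\<lambda>x. (R (A x e) e)\<^sup>2)) {0..1}"
    using e by (intro has_integral_mult_right integral_over_positions continuous_intros) auto
  ultimately have IR: "kap * integral {0..1} (\<lambda>x. (R (A x e) e)\<^sup>2)
      = (h e)\<^sup>2 / (4 * lam) * (Z e / F e + 2 * k * (Y e / F e) + k\<^sup>2)"
    by (rule has_integral_unique[symmetric])
  have l1: "lam * p\<^sup>2 = p / 2" using lam_pos by (simp add: p_def power2_eq_square)
  have l2: "x / (4 * lam) = p / 2 * x" for x by (simp add: p_def)
  have l3: "(lam + 1) * (p * L)\<^sup>2 = p / 2 * L\<^sup>2 + p\<^sup>2 * L\<^sup>2"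
    unfolding l1[symmetric] by (simp add: power_mult_distrib distrib_right)
  have l4: "(1 + lam) * ((h e * p)\<^sup>2 * x) = (h e)\<^sup>2 * ((p / 2 + p\<^sup>2) * x)" for x
    unfolding l1[symmetric] by (simp add: power_mult_distrib algebra_simps)
  have "source e = (h e)\<^sup>2 * ((lam + 1) * (p * L)\<^sup>2 - p * (p + 1) * z - p * L * k - k\<^sup>2 / (4 * lam))"
    by (simp add: source_def L_z_k_def power_divide)
  also have "\<dots> = - ((h e)\<^sup>2 / (4 * lam) * (z + 2 * k * L + k\<^sup>2))
      - (1 + lam) * ((h e * p)\<^sup>2 * (z + 2 * - L * L + (- L)\<^sup>2))"
    unfolding l2 l3 l4
    by (simp add: power2_eq_square algebra_simps add_divide_distrib diff_divide_distrib)
  finally show ?thesis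
    using IR IW unfolding L_z_k_def by simp
qed

text \<open>The time at which \<open>eta\<close> reaches a given value.\<close>

definition tau :: "real \<Rightarrow> real" where
  "tau = prim (\<lambda>e. 1 / h e)"

lemma continuous_on_inverse_h: "continuous_on {-1<..<1} (\<lambda>e. 1 / h e)"
proof (intro continuous_intros)
  show "\<forall>e\<in>{-1<..<1}. h e \<noteq> 0" using h_pos by fastforce
qed auto

lemma tau_deriv:
  assumes "- 1 < e" "e < 1"
  shows "(tau has_real_derivative 1 / h e) (at e)"
proof -
  define q where "q = (\<bar>e\<bar> + 1) / 2"
  have q: "\<bar>e\<bar> < q" "q < 1" using assms by (auto simp: q_def)
  show ?thesis
    unfolding tau_def
    by (rule has_real_derivative_prim[of "- q" q])
      (use q in \<open>auto intro!: continuous_on_subset[OF continuous_on_inverse_h]\<close>)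
qed

lemma tau_0: "tau 0 = 0"
  by (simp add: tau_def)

lemma tau_less: "- 1 < x \<Longrightarrow> x < y \<Longrightarrow> y < 1 \<Longrightarrow> tau x < tau y"
proof -
  assume xy: "- 1 < x" "x < y" "y < 1"
  show "tau x < tau y"
  proof (rule DERIV_pos_imp_increasing[OF xy(2)])
    fix z assume "x \<le> z" "z \<le> y"
    then have "- 1 < z" "z < 1" using xy by auto
    then show "\<exists>d. (tau has_real_derivative d) (at z) \<and> 0 < d"
      using tau_deriv[of z] h_pos[of z] by (intro exI[of _ "1 / h z"]) simp
  qed
qed

lemma tau_less_iff:
  "- 1 < x \<Longrightarrow> x < 1 \<Longrightarrow> - 1 < y \<Longrightarrow> y < 1 \<Longrightarrow> tau x < tau y \<longleftrightarrow> x < y"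
  using tau_less[of x y] tau_less[of y x] by (cases x y rule: linorder_cases) auto

text \<open>The derivative of \<open>tau\<close> is at most a multiple of \<open>(1 - e) powr (1 / r - 1)\<close>, which is the derivative of a
bounded function.\<close>

lemma tau_bounded: "bdd_above (tau ` {0..<1})"
proof -
  obtain c where c: "0 < c"
    "\<And>e. 1 / 2 \<le> e \<Longrightarrow> e < 1 \<Longrightarrow> c * (1 - e) powr (1 - 1 / r) \<le> F e powr (- 2 * lam)"
    by (rule F_powr_growth) (rule that)
  have bound: "tau e \<le> tau (1 / 2) + r / c * (1 / 2) powr (1 / r)" if e: "1 / 2 \<le> e" "e < 1" for e
  proof -
    have "tau e + r / c * (1 - e) powr (1 / r) \<le> tau (1 / 2) + r / c * (1 - 1 / 2) powr (1 / r)"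
    proof (rule DERIV_nonpos_imp_nonincreasing[OF e(1)])
      fix x assume x: "1 / 2 \<le> x" "x \<le> e"
      then have x1: "x < 1" "0 < 1 - x" using e by auto
      have "((\<lambda>x. tau x + r / c * (1 - x) powr (1 / r)) has_real_derivative
          1 / h x + r / c * (1 / r * (1 - x) powr (1 / r - 1) * (- 1))) (at x)"
        using x x1 by (intro DERIV_add DERIV_cmult tau_deriv) (auto intro!: derivative_eq_intros)
      moreover have "1 / h x \<le> 1 / (c * (1 - x) powr (1 - 1 / r))"
        using c(1) c(2)[OF x(1) x1(1)] F_powr_le_h[of x] x x1 by (intro frac_le) auto
      moreover have "1 / (c * (1 - x) powr (1 - 1 / r)) = r / c * (1 / r * (1 - x) powr (1 / r - 1))"
        using powr_minus_divide[of "1 - x" "1 - 1 / r"] c(1) r_bounds by simp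
      ultimately show "\<exists>y. ((\<lambda>x. tau x + r / c * (1 - x) powr (1 / r)) has_real_derivative y) (at x) \<and> y \<le> 0"
        by (intro exI conjI) (assumption, simp)
    qed
    moreover have "0 \<le> r / c * (1 - e) powr (1 / r)"
      using c(1) r_bounds by simp
    ultimately show ?thesis by simp
  qed
  have "tau e \<le> tau (1 / 2) + r / c * (1 / 2) powr (1 / r)" if "e \<in> {0..<1}" for e
  proof (cases "1 / 2 \<le> e")
    case True
    then show ?thesis using bound that by simp
  next
    case False
    then have "tau e < tau (1 / 2)" using that by (intro tau_less) auto
    then show ?thesis using c(1) r_bounds by (simp add: add_increasing2)
  qed
  then show ?thesis by (intro bdd_aboveI2)
qed

definition t_star :: real where
  "t_star = (SUP e\<in>{0..<1}. tau e)"

lemma tau_less_t_star: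
  assumes "- 1 < e" "e < 1"
  shows "tau e < t_star"
proof -
  define e' where "e' = (max e 0 + 1) / 2"
  have e': "e < e'" "0 \<le> e'" "e' < 1" using assms by (auto simp: e'_def max_def)
  have "tau e < tau e'" using assms e' by (intro tau_less) auto
  also have "tau e' \<le> t_star"
    unfolding t_star_def using e' by (intro cSUP_upper tau_bounded) auto
  finally show ?thesis .
qed

lemma t_star_pos: "0 < t_star"
  using tau_less_t_star[of 0] by (simp add: tau_0)

lemma less_t_star_obtain:
  assumes "t < t_star"
  obtains e where "0 \<le> e" "e < 1" "t < tau e"
  using assms less_cSUP_iff[OF _ tau_bounded] unfolding t_star_def by auto

lemma tau_tendsto: "(tau \<longlongrightarrow> t_star) (at_left 1)"
proof (rule increasing_tendsto)
  show "eventually (\<lambda>e. tau e \<le> t_star) (at_left 1)"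
    using tau_less_t_star by (auto intro!: eventually_at_leftI[of 0] less_imp_le)
  fix t assume "t < t_star"
  then obtain e where e: "0 \<le> e" "e < 1" "t < tau e" by (rule less_t_star_obtain)
  then show "eventually (\<lambda>e. t < tau e) (at_left 1)"
    by (auto intro!: eventually_at_leftI[of e] intro: less_trans[OF e(3) tau_less])
qed

text \<open>A slightly negative starting time, so that \<open>eta\<close> has a two-sided derivative at zero.\<close>

definition t_neg :: real where "t_neg = tau (- (1 / 2))"

definition eta :: "real \<Rightarrow> real" where
  "eta t = (THE e. - 1 < e \<and> e < 1 \<and> tau e = t)"

lemma t_neg_neg: "t_neg < 0"
  using tau_less[of "- (1 / 2)" 0] by (simp add: t_neg_def tau_0)

lemma eta_tau:
  assumes "- 1 < e" "e < 1"
  shows "eta (tau e) = e"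
  unfolding eta_def
proof (rule the_equality)
  fix e' assume "- 1 < e' \<and> e' < 1 \<and> tau e' = tau e"
  then show "e' = e"
    using assms tau_less[of e e'] tau_less[of e' e] by (cases e e' rule: linorder_cases) auto
qed (use assms in auto)

lemma eta_props:
  assumes "t_neg < t" "t < t_star"
  shows "- (1 / 2) < eta t" "eta t < 1" "tau (eta t) = t"
proof -
  obtain e where e: "0 \<le> e" "e < 1" "t < tau e" using assms(2) by (rule less_t_star_obtain)
  have "\<exists>x\<ge>- (1 / 2). x \<le> e \<and> tau x = t"
  proof (rule IVT)
    show "\<forall>x. - (1 / 2) \<le> x \<and> x \<le> e \<longrightarrow> isCont tau x"
      using e by (auto intro!: DERIV_isCont[OF tau_deriv])
  qed (use e assms in \<open>auto simp: t_neg_def\<close>)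
  then obtain x where x: "- (1 / 2) \<le> x" "x \<le> e" "tau x = t" by blast
  moreover have "x \<noteq> - (1 / 2)" using x assms by (auto simp: t_neg_def)
  ultimately show "- (1 / 2) < eta t" "eta t < 1" "tau (eta t) = t"
    using eta_tau[of x] e by auto
qed

lemma eta_0: "eta 0 = 0"
  using eta_tau[of 0] by (simp add: tau_0)

lemma eta_less:
  assumes "t_neg < s" "s < t" "t < t_star"
  shows "eta s < eta t"
  using eta_props[of s] eta_props[of t] assms tau_less_iff[of "eta s" "eta t"] by simp

lemma eta_range: "0 \<le> t \<Longrightarrow> t < t_star \<Longrightarrow> 0 \<le> eta t \<and> eta t < 1"
  using eta_less[of 0 t] eta_props[of t] t_neg_neg by (cases "t = 0") (auto simp: eta_0)

lemma eta_deriv: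
  assumes t: "t_neg < t" "t < t_star"
  shows "(eta has_real_derivative h (eta t)) (at t)"
proof -
  define e where "e = eta t"
  have e: "- (1 / 2) < e" "e < 1" "tau e = t" using eta_props[OF t] by (simp_all add: e_def)
  define b where "b = (e + 1) / 2"
  have b: "e < b" "b < 1" using e by (auto simp: b_def)
  have "isCont eta (tau e)"
    by (rule isCont_inverse_function2[of "- (1 / 2)" e b])
      (use e b in \<open>auto intro!: eta_tau DERIV_isCont[OF tau_deriv]\<close>)
  then have "(eta has_real_derivative inverse (1 / h e)) (at t)"
    using t e eta_props h_pos[of e]
    by (intro DERIV_inverse_function[of tau "1 / h e" eta t t_neg t_star])
      (auto simp: e_def[symmetric] intro!: tau_deriv)
  then show ?thesis by (simp add: e_def)
qed

lemma continuous_on_eta [continuous_intros]: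
  fixes X :: "'a::t2_space set"
  assumes "continuous_on X g" "\<And>x. x \<in> X \<Longrightarrow> 0 \<le> g x" "\<And>x. x \<in> X \<Longrightarrow> g x < t_star"
  shows "continuous_on X (\<lambda>x. eta (g x))"
proof -
  have "isCont eta t" if "t \<in> {t_neg<..<t_star}" for t
    using that by (intro DERIV_isCont[OF eta_deriv]) auto
  then have "continuous_on {t_neg<..<t_star} eta"
    by (intro continuous_at_imp_continuous_on) blast
  then show ?thesis
    using assms t_neg_neg by (intro continuous_on_compose2[of "{t_neg<..<t_star}" eta X g]) force+
qed

lemma eta_at_left: "filterlim eta (at_left 1) (at_left t_star)"
  unfolding filterlim_at
proof
  show "eventually (\<lambda>t. eta t \<in> {..<1} \<and> eta t \<noteq> 1) (at_left t_star)"
  proof (rule eventually_at_leftI[OF _ t_star_pos])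
    show "eta t \<in> {..<1} \<and> eta t \<noteq> 1" if "t \<in> {0<..<t_star}" for t
      using eta_range[of t] that by auto
  qed
  show "(eta \<longlongrightarrow> 1) (at_left t_star)"
  proof (rule increasing_tendsto)
    show "eventually (\<lambda>t. eta t \<le> 1) (at_left t_star)"
    proof (rule eventually_at_leftI[OF _ t_star_pos])
      show "eta t \<le> 1" if "t \<in> {0<..<t_star}" for t
        using eta_range[of t] that by auto
    qed
    fix x :: real assume "x < 1"
    define y where "y = max x 0"
    have y: "x \<le> y" "0 \<le> y" "y < 1" using \<open>x < 1\<close> by (auto simp: y_def)
    have "0 \<le> tau y" using y tau_less[of 0 y] by (cases "y = 0") (auto simp: tau_0)
    have "tau y < t_star" using y by (intro tau_less_t_star) auto
    then show "eventually (\<lambda>t. x < eta t) (at_left t_star)"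
    proof (rule eventually_at_leftI[rotated])
      fix t assume "t \<in> {tau y<..<t_star}"
      then have "eta (tau y) < eta t"
        using \<open>0 \<le> tau y\<close> t_neg_neg by (intro eta_less) auto
      then show "x < eta t" using y eta_tau[of y] by simp
    qed
  qed
qed

end

section \<open>The initial data\<close>

lemma deriv_trig_poly:
  fixes a b c w :: real
  shows "deriv (\<lambda>x. a + b * sin (w * x) + c * cos (w * x))
    = (\<lambda>x. 0 + (- c * w) * sin (w * x) + (b * w) * cos (w * x))"
  by (intro ext DERIV_imp_deriv) (auto intro!: derivative_eq_intros)

lemma smooth_trig_poly: "smooth (\<lambda>x. a + b * sin (w * x) + c * cos (w * x))"
proof -
  have "(deriv ^^ n) (\<lambda>x. a + b * sin (w * x) + c * cos (w * x)) field_differentiable (at x)" for n x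
  proof (induction n arbitrary: a b c)
    case 0
    have "((\<lambda>x. a + b * sin (w * x) + c * cos (w * x)) has_real_derivative
        0 + (- c * w) * sin (w * x) + (b * w) * cos (w * x)) (at x)"
      by (auto intro!: derivative_eq_intros)
    then show ?case by (auto simp: field_differentiable_def)
  next
    case (Suc n)
    then show ?case by (simp only: funpow_Suc_right o_def deriv_trig_poly)
  qed
  then show ?thesis by (simp add: smooth_def)
qed

lemma bump_eq_1_iff:
  assumes "a \<in> {0..1}"
  shows "bump a = 1 \<longleftrightarrow> a = 1 / 2"
proof
  assume "bump a = 1"
  then have "sin (pi * (a - 1 / 2)) = 0" using bump_shift[of "a - 1 / 2"] by simp
  moreover have "- (pi * 1) < pi * (a - 1 / 2)" "pi * (a - 1 / 2) < pi * 1"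
    unfolding mult_minus_right[symmetric] using assms by (simp_all only: mult_less_cancel_left_pos pi_gt_zero) auto
  ultimately have "pi * (a - 1 / 2) = 0" using sin_eq_0_pi[of "pi * (a - 1 / 2)"] by simp
  then show "a = 1 / 2" by simp
next
  assume a: "a = 1 / 2"
  show "bump a = 1" unfolding a using bump_shift[of 0] by simp
qed

lemma bump_eq_0_iff:
  assumes "a \<in> {0..1}"
  shows "bump a = 0 \<longleftrightarrow> a = 0 \<or> a = 1"
proof
  assume "bump a = 0"
  then have s: "sin (pi * a) = 0" by (simp add: bump_def)
  show "a = 0 \<or> a = 1"
  proof (cases "a = 1")
    case False
    then have "pi * a < pi * 1" "- pi < pi * a"
      using assms by (auto intro: less_le_trans[of _ 0])
    then have "pi * a = 0" using sin_eq_0_pi[of "pi * a"] s by simp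
    then show ?thesis by simp
  qed simp
qed (auto simp: bump_def)

lemma integral_odd_periodic:
  fixes f :: "real \<Rightarrow> real"
  assumes f: "\<And>x. f (- x) = - f x" "\<And>x. f (x + 1) = f x"
  shows "integral {0..1} f = 0"
proof -
  have "integral {0..1} f = integral {- 1..0} (\<lambda>x. f (- x))"
    using Henstock_Kurzweil_Integration.integral_reflect_real[of 1 0 f] by simp
  also have "\<dots> = - integral {- 1..0} f" by (simp add: f(1))
  also have "integral {- 1..0} f = integral {0..1} f"
    using integral_shift_real_ivl[of 0 1 1 f] by (simp add: f(2))
  finally show ?thesis by simp
qed

context ghs_data
begin

text \<open>The mean-zero primitive of \<open>(2 * S - 1) / (4 * lam)\<close> for \<open>S = sin\<^sup>2 (pi * x)\<close>.\<close>

definition U0 :: "real \<Rightarrow> real" where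
  "U0 x = - sin (2 * pi * x) / (8 * pi * lam)"

lemma deriv_U0: "deriv U0 x = (2 * bump x - 1) / (4 * lam)"
proof -
  have "(U0 has_real_derivative - (cos (2 * pi * x) * (2 * pi)) / (8 * pi * lam)) (at x)"
    unfolding U0_def by (intro DERIV_cdivide) (auto intro!: derivative_eq_intros)
  then have "deriv U0 x = - (cos (2 * pi * x) * (2 * pi)) / (8 * pi * lam)"
    by (rule DERIV_imp_deriv)
  then show ?thesis
    using lam_pos by (simp add: bump_eq_cos field_simps)
qed

lemma kap_R0_square: "kap * (R0 x)\<^sup>2 = (1 + 2 * bump x)\<^sup>2 / (16 * lam)"
  using lam_pos kap_pos by (simp add: R0_def power_divide power_mult_distrib)

lemma Cfun_eq: "Cfun lam kap U0 R0 x = - bump x / 2"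
proof -
  have "Cfun lam kap U0 R0 x = lam\<^sup>2 * ((2 * bump x - 1) / (4 * lam))\<^sup>2 - lam * (kap * (R0 x)\<^sup>2)"
    by (simp add: Cfun_def deriv_U0 power2_eq_square algebra_simps)
  also have "\<dots> = (2 * bump x - 1)\<^sup>2 / 16 - (1 + 2 * bump x)\<^sup>2 / 16"
    unfolding kap_R0_square using lam_pos by (simp add: power_divide power_mult_distrib)
  also have "\<dots> = - bump x / 2" by (simp add: power2_eq_square field_simps)
  finally show ?thesis .
qed

text \<open>The roots of \<open>Q\<close> in \<open>e\<close> are the reciprocals of \<open>lam * u0' + sqrt (lam * kap) * rho0 = bump x\<close> and
\<open>lam * u0' - sqrt (lam * kap) * rho0 = - 1 / 2\<close>.\<close>

lemma Q_eq: "Q lam kap U0 R0 x e = (1 + e / 2) * dfac x e"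
proof -
  have "2 * lam * deriv U0 x = bump x - 1 / 2" using lam_pos by (simp add: deriv_U0 field_simps)
  then show ?thesis
    unfolding Q_def Cfun_eq dfac_def by (simp only:) (simp add: power2_eq_square algebra_simps)
qed

lemma P0bar_eq:
  assumes "0 \<le> e" "e < 1"
  shows "P0bar lam kap U0 R0 e = (1 + e / 2) powr (- p) * F e"
proof -
  have "Q lam kap U0 R0 a e powr (- (1 / (2 * lam))) = (1 + e / 2) powr (- p) * kern 0 p a e" for a
    using assms dfac_pos[OF assms(2), of a] by (simp add: Q_eq powr_mult kern_def p_def)
  then show ?thesis by (simp add: P0bar_def F_def moment_eq)
qed

lemma P0bar_powr:
  assumes "0 \<le> e" "e < 1"
  shows "P0bar lam kap U0 R0 e powr (- 2 * lam) = h e" "P0bar lam kap U0 R0 e powr (2 * lam) = 1 / h e"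
proof -
  have "p * (2 * lam) = 1" using two_lam_p by (simp add: mult.commute)
  then have "P0bar lam kap U0 R0 e powr (2 * lam) = (1 + e / 2) powr - 1 * F e powr (2 * lam)"
    using assms F_pos[OF assms(2)] by (simp add: P0bar_eq powr_mult powr_powr)
  also have "\<dots> = 1 / h e"
  proof -
    have "F e powr (2 * lam) = 1 / F e powr (- 2 * lam)"
      using powr_minus_divide[of "F e" "- 2 * lam"] by simp
    moreover have "(1 + e / 2) powr - 1 = 1 / (1 + e / 2)"
      using assms by (intro powr_neg_one) simp
    ultimately show ?thesis by (simp only: h_def times_divide_times_eq mult_1)
  qed
  finally show 1: "P0bar lam kap U0 R0 e powr (2 * lam) = 1 / h e" .
  then show "P0bar lam kap U0 R0 e powr (- 2 * lam) = h e"
    using powr_minus[of "P0bar lam kap U0 R0 e" "2 * lam"] by simp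
qed

lemma rho_formula_eq:
  assumes "0 \<le> e" "e < 1"
  shows "rho_formula lam kap U0 R0 a e = R a e"
  using assms unfolding rho_formula_def P0bar_powr(1)[OF assms] R_def h_def Q_eq by simp

text \<open>The numerator is \<open>- 1 / 2\<close> times the derivative of \<open>Q\<close> in \<open>e\<close>.  The factor \<open>1 + e / 2\<close> contributes the
same constant to the local term and to the mean term, and the two contributions cancel.\<close>

lemma ux_formula_eq:
  assumes e: "0 \<le> e" "e < 1"
  shows "ux_formula lam kap U0 R0 a e = W a e"
proof -
  define k where "k = 1 + e / 2"
  have k: "0 < k" using e by (simp add: k_def)
  have num: "lam * deriv U0 x - e * Cfun lam kap U0 R0 x = (bump x * k - dfac x e / 2) / 2" for x
    using lam_pos by (simp add: deriv_U0 Cfun_eq k_def dfac_def field_simps)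
  have "(lam * deriv U0 x - e * Cfun lam kap U0 R0 x) / Q lam kap U0 R0 x e powr (1 + 1 / (2 * lam))
      = k powr - p / (2 * k) * (k * kern 1 (p + 1) x e - kern 0 p x e / 2)" for x
  proof -
    have D: "0 < dfac x e" by (rule dfac_pos) fact
    have "Q lam kap U0 R0 x e powr (1 + 1 / (2 * lam)) = (k * k powr p) * dfac x e powr (p + 1)"
      unfolding Q_eq k_def[symmetric] using k D
      by (simp add: powr_mult powr_add p_def mult_ac)
    then have "(lam * deriv U0 x - e * Cfun lam kap U0 R0 x) / Q lam kap U0 R0 x e powr (1 + 1 / (2 * lam))
        = k powr - p / (2 * k) * ((bump x * k - dfac x e / 2) * dfac x e powr (- (p + 1)))"
      unfolding num powr_minus using k D by (simp add: field_simps)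
    also have "(bump x * k - dfac x e / 2) * dfac x e powr (- (p + 1))
        = k * kern 1 (p + 1) x e - kern 0 p x e / 2"
      unfolding kern_0_eq[OF e(2), of p x] by (simp add: kern_def algebra_simps)
    finally show ?thesis .
  qed
  moreover have "((\<lambda>x. k powr - p / (2 * k) * (k * kern 1 (p + 1) x e - kern 0 p x e / 2)) has_integral
      k powr - p / (2 * k) * (k * Y e - F e / 2)) {0..1}"
    unfolding Y_def F_def
    by (intro has_integral_mult_right has_integral_diff has_integral_divide kern_has_integral e)
  ultimately have int: "integral {0..1} (\<lambda>x. (lam * deriv U0 x - e * Cfun lam kap U0 R0 x)
      / Q lam kap U0 R0 x e powr (1 + 1 / (2 * lam))) = k powr - p / (2 * k) * (k * Y e - F e / 2)"
    by (simp only: integral_unique)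
  have D: "0 < dfac a e" by (rule dfac_pos) fact
  have "ux_formula lam kap U0 R0 a e = h e / lam *
      ((bump a * k - dfac a e / 2) / 2 / (k * dfac a e)
        - 1 / (k powr - p * F e) * (k powr - p / (2 * k) * (k * Y e - F e / 2)))"
    unfolding ux_formula_def P0bar_powr(1)[OF e] int unfolding P0bar_eq[OF e] num Q_eq k_def ..
  also have "(bump a * k - dfac a e / 2) / 2 / (k * dfac a e)
        - 1 / (k powr - p * F e) * (k powr - p / (2 * k) * (k * Y e - F e / 2))
      = (bump a / dfac a e - Y e / F e) / 2"
  proof -
    have "1 / (k powr - p * F e) * (k powr - p / (2 * k) * (k * Y e - F e / 2))
        = (k * Y e - F e / 2) / (2 * k * F e)"
      using k by simp
    then show ?thesis
      using k D F_pos[OF e(2)] by (simp only:) (simp add: field_simps)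
  qed
  finally show ?thesis by (simp add: W_def p_def)
qed

lemma data_periodic: "periodic1 U0" "periodic1 R0"
proof -
  have "sin (2 * pi * (x + 1)) = sin (2 * pi * x)" for x
    using sin_periodic[of "2 * pi * x"] by (simp only: distrib_left mult_1_right)
  then show "periodic1 U0" "periodic1 R0"
    by (simp_all only: periodic1_def U0_def R0_def bump_add_1 simp_thms)
qed

lemma smooth_data: "smooth U0" "smooth R0"
proof -
  have "U0 = (\<lambda>x. 0 + (- 1 / (8 * pi * lam)) * sin ((2 * pi) * x) + 0 * cos ((2 * pi) * x))"
    by (simp add: U0_def fun_eq_iff)
  then show "smooth U0" using smooth_trig_poly by metis
  have "R0 = (\<lambda>x. 2 / (4 * sqrt (lam * kap)) + 0 * sin ((2 * pi) * x)
      + (- 1 / (4 * sqrt (lam * kap))) * cos ((2 * pi) * x))"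
    by (simp add: R0_def bump_eq_cos fun_eq_iff diff_divide_distrib)
  then show "smooth R0" using smooth_trig_poly by metis
qed

lemma Omega_eq: "Omega lam kap U0 R0 = {0, 1}"
  by (auto simp: Omega_def Cfun_eq bump_eq_0_iff)

lemma data_admissible: "admissible_data lam kap U0 R0"
  unfolding admissible_data_def Omega_eq
proof (intro conjI)
  show "integral {0..1} U0 = 0"
  proof (rule integral_odd_periodic)
    show "U0 (- x) = - U0 x" for x by (simp add: U0_def)
    show "U0 (x + 1) = U0 x" for x using data_periodic(1) by (simp only: periodic1_def)
  qed
  show "\<exists>\<alpha>\<in>{0..1}. R0 \<alpha> \<noteq> 0" using R0_pos[of 0] by (intro bexI[of _ 0]) auto
  show "\<exists>\<alpha>\<in>{0..1}. Cfun lam kap U0 R0 \<alpha> \<noteq> 0"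
    by (intro bexI[of _ "1 / 2"]) (auto simp: Cfun_eq at_peak)
qed (use smooth_data data_periodic in auto)

lemma eta_star_is_1: "is_eta_star lam kap U0 R0 1"
  unfolding is_eta_star_def Q_eq
  using dfac_neq_0 by (auto simp: at_peak intro!: bexI[of _ "1 / 2"])

lemma M_dom_eq: "M_dom lam kap U0 R0 = {0, 1}"
  using R0_pos by (auto simp: M_dom_def Omega_eq less_imp_neq[symmetric])

lemma N_dom_eq: "N_dom lam kap U0 R0 = {a \<in> {0..1}. bump a \<noteq> 0}"
  using R0_pos by (auto simp: N_dom_def Sigma_set_def Cfun_eq less_imp_neq[symmetric])

lemma N_val_eq: "N_val lam kap U0 R0 a = bump a"
proof -
  have "sqrt (lam * kap) * \<bar>R0 a\<bar> = (1 + 2 * bump a) / 4"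
  proof -
    have cancel: "q * (b / (4 * q)) = b / 4" if "0 < q" for q b :: real using that by simp
    show ?thesis
      unfolding abs_of_pos[OF R0_pos] unfolding R0_def by (rule cancel) (rule sqrt_lam_kap_pos)
  qed
  then show ?thesis
    using lam_pos by (simp add: N_val_def deriv_U0 field_simps)
qed

lemma M_val_ends: "M_val lam U0 0 = - (1 / 2)" "M_val lam U0 1 = - (1 / 2)"
  using lam_pos by (simp_all add: M_val_def deriv_U0 bump_def)

lemma is_M_iff: "is_M lam kap U0 R0 x \<longleftrightarrow> x = - (1 / 2)"
  by (auto simp: is_M_def M_dom_eq M_val_ends is_max_def)

lemma is_N_iff: "is_N lam kap U0 R0 x \<longleftrightarrow> x = 1"
proof -
  define S where "S = bump ` {a \<in> {0..1}. bump a \<noteq> 0}"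
  have S1: "1 \<in> S"
    unfolding S_def by (rule image_eqI[of _ _ "1 / 2"]) (auto simp: at_peak)
  have le: "y \<le> 1" if "y \<in> S" for y
    using that bump_bounds(2) by (auto simp: S_def)
  have "is_N lam kap U0 R0 x \<longleftrightarrow> x \<in> S \<and> (\<forall>y\<in>S. y \<le> x)"
    by (simp only: is_N_def N_dom_eq N_val_eq[abs_def] is_max_def S_def)
  also have "\<dots> \<longleftrightarrow> x = 1"
  proof
    assume x: "x \<in> S \<and> (\<forall>y\<in>S. y \<le> x)"
    then have "x \<le> 1" "1 \<le> x" using le[of x] S1 by (simp_all only:)
    then show "x = 1" by simp
  next
    assume "x = 1"
    then show "x \<in> S \<and> (\<forall>y\<in>S. y \<le> x)" using S1 le by (simp only:) blast
  qed
  finally show ?thesis .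
qed

text \<open>The maximum over the points where \<open>C\<close> vanishes is \<open>- 1 / 2\<close>, so the other one, attained at the peak, decides.\<close>

lemma is_larger_MN_iff: "is_larger_MN lam kap U0 R0 x \<longleftrightarrow> x = 1"
  by (auto simp: is_larger_MN_def is_M_iff is_N_iff is_max_def)

lemma alpha_bar_eq: "alpha_bar lam kap U0 R0 = {1 / 2}"
  by (auto simp: alpha_bar_def is_larger_MN_iff is_M_iff is_N_iff N_dom_eq N_val_eq bump_eq_1_iff at_peak)

lemma Q_zero_set: "{\<alpha>\<in>{0..1}. Q lam kap U0 R0 \<alpha> 1 = 0} = {1 / 2}"
  by (auto simp: Q_eq dfac_def bump_eq_1_iff at_peak)

lemma single_root: "order 1 (Q_poly lam kap U0 R0 (1 / 2)) = 1"
proof -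
  have "Q_poly lam kap U0 R0 (1 / 2) = [:- 1, 1:] * [:- 1, - 1 / 2:]"
    using lam_pos by (simp add: Q_poly_def Cfun_eq deriv_U0 at_peak)
  moreover have "order 1 ([:- 1, 1:] * [:- 1, - 1 / 2 :: real:])
      = order 1 [:- 1, 1 :: real:] + order 1 [:- 1, - 1 / 2 :: real:]"
    by (rule order_mult) simp
  moreover have "order 1 [:- 1, - 1 / 2 :: real:] = 0" by (rule order_0I) simp
  moreover have "order 1 [:- 1, 1 :: real:] = 1" using order_power_n_n[of "1::real" 1] by simp
  ultimately show ?thesis by simp
qed

end

section \<open>The solution of the system\<close>

context ghs_data
begin

text \<open>The derivative of the characteristic map in time, as a function of position.\<close>

definition u :: "real \<Rightarrow> real \<Rightarrow> real" where
  "u x t = h (eta t) * Ge (A x (eta t)) (eta t)"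

definition rho :: "real \<Rightarrow> real \<Rightarrow> real" where
  "rho x t = R (A x (eta t)) (eta t)"

definition gamma :: "real \<Rightarrow> real \<Rightarrow> real" where
  "gamma a t = G a (eta t)"

lemma Ge_minus: "Ge (- a) e = - Ge a e"
  unfolding Ge_def kern_prim_minus by (simp add: diff_divide_distrib right_diff_distrib)

lemma Ge_add_1: "e < 1 \<Longrightarrow> Ge (a + 1) e = Ge a e"
  unfolding Ge_def by (simp only: kern_prim_add_1) (simp add: F_def Y_def algebra_simps)

lemma profiles_add_1: "W (a + 1) e = W a e" "R (a + 1) e = R a e"
  by (simp_all add: W_def R_def R0_def dfac_def bump_add_1)

lemma F_at_0: "F 0 = 1"
  by (simp add: F_def moment_eq kern_def dfac_def)

lemma kern_prim_at_0:
  "kern_prim 0 q a 0 = a" "kern_prim 1 q a 0 = a / 2 - sin (2 * pi * a) / (4 * pi)"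
proof -
  show "kern_prim 0 q a 0 = a" by (simp add: kern_prim_def prim_def kern_def dfac_def)
  define g where "g a = a / 2 - sin (2 * pi * a) / (4 * pi)" for a :: real
  have "(g has_real_derivative bump y) (at y within S)" for y S
    unfolding g_def bump_eq_cos by (auto intro!: derivative_eq_intros simp: field_simps)
  then have "prim bump a = g a - g 0"
    by (intro prim_eq_diff[of "- \<bar>a\<bar>" "\<bar>a\<bar>"])
      (auto simp: has_real_derivative_iff_has_vector_derivative[symmetric])
  moreover have "kern 1 q y 0 = bump y" for y by (simp add: kern_def dfac_def)
  ultimately show "kern_prim 1 q a 0 = a / 2 - sin (2 * pi * a) / (4 * pi)"
    by (simp add: kern_prim_def g_def)
qed

lemma A_at_0: "A x 0 = x"
  using A_G[of 0 x] by (simp add: G_def F_at_0 kern_prim_at_0)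

lemma u_at_0: "u x 0 = U0 x"
proof -
  have Y0: "Y 0 = 1 / 2" using kern_prim_at_0(2)[of "p + 1" 1] by (simp add: Y_def)
  have "u x 0 = p * (x / 2 - sin (2 * pi * x) / (4 * pi) - x * (1 / 2))"
    unfolding u_def eta_0 A_at_0 Ge_def kern_prim_at_0 F_at_0 h_def Y0 by simp
  also have "\<dots> = U0 x" by (simp add: U0_def p_def)
  finally show ?thesis .
qed

lemma rho_at_0: "rho x 0 = R0 x"
  by (simp add: rho_def eta_0 A_at_0 R_def F_at_0 dfac_def)

lemma u_deriv_space:
  assumes "0 \<le> t" "t < t_star"
  shows "((\<lambda>x. u x t) has_real_derivative W (A x (eta t)) (eta t)) (at x)"
proof -
  define e where "e = eta t"
  have e: "e < 1" using eta_range[OF assms] by (simp add: e_def)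
  have "((\<lambda>x. h e * Ge (A x e) e) has_real_derivative
      h e * (Ga (A x e) e * (p * (bump (A x e) / dfac (A x e) e - Y e / F e)) * (1 / Ga (A x e) e))) (at x)"
    by (intro DERIV_cmult DERIV_chain2[OF Ge_deriv_space A_deriv_space] e)
  then show ?thesis
    using Ga_pos[OF e, of "A x e"] by (simp add: u_def W_def e_def)
qed

lemma pdx_u: "0 \<le> t \<Longrightarrow> t < t_star \<Longrightarrow> pdx u x t = W (A x (eta t)) (eta t)"
  unfolding pdx_def by (intro DERIV_imp_deriv u_deriv_space)

lemma A_deriv_time:
  assumes "0 < t" "t < t_star"
  shows "((\<lambda>s. A x (eta s)) has_real_derivative
    - Ge (A x (eta t)) (eta t) / Ga (A x (eta t)) (eta t) * h (eta t)) (at t)"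
  using assms t_neg_neg eta_range[of t]
  by (intro DERIV_chain2[OF A_deriv_param eta_deriv]) auto

text \<open>The time derivatives at a fixed position are the derivatives along the characteristic through it minus
the transport terms.\<close>

lemma profile_derivs:
  fixes x t :: real
  assumes t: "0 < t" "t < t_star"
  defines "e \<equiv> eta t" and "a \<equiv> A x (eta t)"
  shows "((\<lambda>y. pdx u y t) has_real_derivative Wa a e / Ga a e) (at x)"
    and "((\<lambda>s. pdx u x s) has_real_derivative h e * We a e - u x t * (Wa a e / Ga a e)) (at t)"
    and "((\<lambda>y. rho y t) has_real_derivative Ra a e / Ga a e) (at x)"
    and "((\<lambda>s. rho x s) has_real_derivative h e * Re a e - u x t * (Ra a e / Ga a e)) (at t)"
proof -
  have e: "0 \<le> e" "e < 1" using eta_range[of t] t by (simp_all add: e_def)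
  note Ad = A_deriv_space[OF e(2), of x]
  note At = A_deriv_time[OF t, of x]
  have et: "(eta has_real_derivative h (eta t)) (at t)"
    using t t_neg_neg by (intro eta_deriv) auto
  have pdx_t: "(\<lambda>y. pdx u y t) = (\<lambda>y. W (A y e) e)"
    using t by (simp add: pdx_u e_def)
  have "((\<lambda>y. W (A y e) e) has_real_derivative Wa (A x e) e * (1 / Ga (A x e) e) + We (A x e) e * 0) (at x)"
    using e by (intro W_curve_deriv Ad DERIV_const) auto
  then show "((\<lambda>y. pdx u y t) has_real_derivative Wa a e / Ga a e) (at x)"
    by (simp add: pdx_t a_def e_def)
  have "((\<lambda>y. R (A y e) e) has_real_derivative Ra (A x e) e * (1 / Ga (A x e) e) + Re (A x e) e * 0) (at x)"
    using e by (intro R_curve_deriv Ad DERIV_const) auto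
  then show "((\<lambda>y. rho y t) has_real_derivative Ra a e / Ga a e) (at x)"
    by (simp add: rho_def a_def e_def)
  have "((\<lambda>s. W (A x (eta s)) (eta s)) has_real_derivative
      Wa a e * (- Ge a e / Ga a e * h e) + We a e * h e) (at t)"
    unfolding a_def e_def using e by (intro W_curve_deriv At et) (auto simp: e_def)
  then have "((\<lambda>s. W (A x (eta s)) (eta s)) has_real_derivative
      h e * We a e - u x t * (Wa a e / Ga a e)) (at t)"
    by (rule DERIV_cong) (simp add: u_def a_def e_def)
  then show "((\<lambda>s. pdx u x s) has_real_derivative h e * We a e - u x t * (Wa a e / Ga a e)) (at t)"
    using t by (elim has_field_derivative_transform_within_open[where S = "{0<..<t_star}"])
      (auto simp: pdx_u)
  have "((\<lambda>s. R (A x (eta s)) (eta s)) has_real_derivative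
      Ra a e * (- Ge a e / Ga a e * h e) + Re a e * h e) (at t)"
    unfolding a_def e_def using e by (intro R_curve_deriv At et) (auto simp: e_def)
  then show "((\<lambda>s. rho x s) has_real_derivative h e * Re a e - u x t * (Ra a e / Ga a e)) (at t)"
    unfolding rho_def by (rule DERIV_cong) (simp add: u_def a_def e_def)
qed

lemma profile_partials:
  assumes "0 < t" "t < t_star"
  shows "pdx (pdx u) x t = Wa (A x (eta t)) (eta t) / Ga (A x (eta t)) (eta t)"
    and "pdt (pdx u) x t = h (eta t) * We (A x (eta t)) (eta t)
      - u x t * (Wa (A x (eta t)) (eta t) / Ga (A x (eta t)) (eta t))"
    and "pdx rho x t = Ra (A x (eta t)) (eta t) / Ga (A x (eta t)) (eta t)"
    and "pdt rho x t = h (eta t) * Re (A x (eta t)) (eta t)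
      - u x t * (Ra (A x (eta t)) (eta t) / Ga (A x (eta t)) (eta t))"
  using profile_derivs[OF assms, of x]
  by (simp_all add: pdx_def[of "pdx u"] pdx_def[of rho] pdt_def DERIV_imp_deriv)

text \<open>Both equations become \<open>reduced_equation\<close> and \<open>R_transport\<close> at the label of the given position, since
the transport terms of \<open>profile_derivs\<close> cancel.\<close>

lemma u_rho_solve: "solves_ghs lam kap U0 R0 t_star u rho"
proof -
  have less: "eta (snd z) < 1" "- 2 < eta (snd z)" "Ga (A (fst z) (eta (snd z))) (eta (snd z)) \<noteq> 0"
    if "z \<in> UNIV \<times> {0..<t_star}" for z :: "real \<times> real"
    using that eta_range[of "snd z"] Ga_pos[of "eta (snd z)"] by (auto simp: less_le)
  note [continuous_intros] = continuous_on_fst[OF continuous_on_id] continuous_on_snd[OF continuous_on_id]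
  have cont: "continuous_on (UNIV \<times> {0..<t_star}) (\<lambda>(x, t). u x t)"
    "continuous_on (UNIV \<times> {0..<t_star}) (\<lambda>(x, t). W (A x (eta t)) (eta t))"
    "continuous_on (UNIV \<times> {0..<t_star}) (\<lambda>(x, t). rho x t)"
    "continuous_on (UNIV \<times> {0..<t_star}) (\<lambda>(x, t). Wa (A x (eta t)) (eta t) / Ga (A x (eta t)) (eta t))"
    "continuous_on (UNIV \<times> {0..<t_star}) (\<lambda>(x, t). h (eta t) * We (A x (eta t)) (eta t)
      - u x t * (Wa (A x (eta t)) (eta t) / Ga (A x (eta t)) (eta t)))"
    "continuous_on (UNIV \<times> {0..<t_star}) (\<lambda>(x, t). Ra (A x (eta t)) (eta t) / Ga (A x (eta t)) (eta t))"
    "continuous_on (UNIV \<times> {0..<t_star}) (\<lambda>(x, t). h (eta t) * Re (A x (eta t)) (eta t)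
      - u x t * (Ra (A x (eta t)) (eta t) / Ga (A x (eta t)) (eta t)))"
    unfolding split_beta u_def rho_def using less
    by (intro continuous_intros; auto)+
  have open_part: "continuous_on (UNIV \<times> {0<..<t_star}) f" if "continuous_on (UNIV \<times> {0..<t_star}) f"
    for f :: "real \<times> real \<Rightarrow> real"
    by (rule continuous_on_subset[OF that]) auto
  have "\<forall>x. u x 0 = U0 x \<and> rho x 0 = R0 x"
    by (simp add: u_at_0 rho_at_0)
  moreover have "\<forall>t\<in>{0..<t_star}. periodic1 (\<lambda>x. u x t) \<and> periodic1 (\<lambda>x. rho x t) \<and>
        integral {0..1} (\<lambda>x. u x t) = 0 \<and> (\<forall>x. (\<lambda>y. u y t) field_differentiable (at x))"
  proof (intro ballI conjI allI)
    fix t x :: real assume "t \<in> {0..<t_star}"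
    then have t: "0 \<le> t" "t < t_star" and e: "eta t < 1" using eta_range[of t] by auto
    show u1: "periodic1 (\<lambda>x. u x t)" and "periodic1 (\<lambda>x. rho x t)"
      using e by (simp_all add: periodic1_def u_def rho_def A_add_1 Ge_add_1 profiles_add_1)
    show "integral {0..1} (\<lambda>x. u x t) = 0"
    proof (rule integral_odd_periodic)
      show "u (- x) t = - u x t" for x using e by (simp add: u_def A_minus Ge_minus)
      show "u (x + 1) t = u x t" for x using u1 by (simp add: periodic1_def)
    qed
    show "(\<lambda>y. u y t) field_differentiable (at x)"
      using u_deriv_space[OF t] by (auto simp: field_differentiable_def)
  qed
  moreover have "continuous_on (UNIV \<times> {0..<t_star}) (\<lambda>(x, t). pdx u x t)"
    using cont(2) by (rule continuous_on_eq) (auto simp: pdx_u)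
  moreover have "continuous_on (UNIV \<times> {0<..<t_star}) (\<lambda>(x, t). pdx (pdx u) x t)"
    using open_part[OF cont(4)] by (rule continuous_on_eq) (auto simp: profile_partials)
  moreover have "continuous_on (UNIV \<times> {0<..<t_star}) (\<lambda>(x, t). pdt (pdx u) x t)"
    using open_part[OF cont(5)] by (rule continuous_on_eq) (auto simp: profile_partials)
  moreover have "continuous_on (UNIV \<times> {0<..<t_star}) (\<lambda>(x, t). pdx rho x t)"
    using open_part[OF cont(6)] by (rule continuous_on_eq) (auto simp: profile_partials)
  moreover have "continuous_on (UNIV \<times> {0<..<t_star}) (\<lambda>(x, t). pdt rho x t)"
    using open_part[OF cont(7)] by (rule continuous_on_eq) (auto simp: profile_partials)
  moreover have "(\<lambda>y. pdx u y t) field_differentiable (at x)"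
    "(\<lambda>s. pdx u x s) field_differentiable (at t)"
    "(\<lambda>y. rho y t) field_differentiable (at x)"
    "(\<lambda>s. rho x s) field_differentiable (at t)" if "t \<in> {0<..<t_star}" for t x
    using profile_derivs[of t x] that unfolding field_differentiable_def by auto
  moreover have "pdt (pdx u) x t + u x t * pdx (pdx u) x t - lam * (pdx u x t)\<^sup>2 - kap * (rho x t)\<^sup>2
          = I_nonlocal lam kap u rho t"
    "pdt rho x t + u x t * pdx rho x t = 2 * lam * rho x t * pdx u x t"
    if "t \<in> {0<..<t_star}" for t x
  proof -
    have t: "0 \<le> t" "0 < t" "t < t_star" and e: "- 1 < eta t" "eta t < 1"
      using that eta_range[of t] by auto
    show "pdt (pdx u) x t + u x t * pdx (pdx u) x t - lam * (pdx u x t)\<^sup>2 - kap * (rho x t)\<^sup>2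
          = I_nonlocal lam kap u rho t"
      using reduced_equation[OF e, of "A x (eta t)"] source_eq[OF e]
      by (simp add: profile_partials[OF t(2,3)] pdx_u[OF t(1,3)] rho_def I_nonlocal_def)
    show "pdt rho x t + u x t * pdx rho x t = 2 * lam * rho x t * pdx u x t"
      using R_transport[of "eta t" "A x (eta t)"]
      by (simp add: profile_partials[OF t(2,3)] pdx_u[OF t(1,3)] rho_def)
  qed
  ultimately show ?thesis
    unfolding solves_ghs_def using cont(1,3) by blast
qed

lemma gamma_characteristics: "characteristics t_star u gamma"
  unfolding characteristics_def
proof (intro ballI conjI)
  fix a t :: real
  show "gamma a 0 = a" by (simp add: gamma_def eta_0 G_def F_at_0 kern_prim_at_0)
  assume "t \<in> {0..<t_star}"
  then have t: "t_neg < t" "t < t_star" and e: "eta t < 1" using eta_range[of t] t_neg_neg by auto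
  have "((\<lambda>s. gamma a s) has_real_derivative Ge a (eta t) * h (eta t)) (at t)"
    unfolding gamma_def by (intro DERIV_chain2[OF G_deriv_param eta_deriv] e t)
  then show "((\<lambda>s. gamma a s) has_real_derivative u (gamma a t) t) (at t within {0..<t_star})"
    by (rule has_field_derivative_at_within[THEN DERIV_cong])
      (simp add: u_def gamma_def A_G[OF e] mult.commute)
qed

lemma is_t_star: "is_t_star lam kap U0 R0 1 t_star"
  unfolding is_t_star_def
proof (rule Lim_transform_eventually[OF tau_tendsto])
  have "tau e = integral {0..e} (\<lambda>s. P0bar lam kap U0 R0 s powr (2 * lam))" if "e \<in> {0<..<1}" for e
  proof -
    have "tau e = integral {0..e} (\<lambda>s. 1 / h s)"
      unfolding tau_def using that
      by (intro prim_eq_integral continuous_on_subset[OF continuous_on_inverse_h]) auto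
    also have "\<dots> = integral {0..e} (\<lambda>s. P0bar lam kap U0 R0 s powr (2 * lam))"
      using that by (intro integral_cong) (simp add: P0bar_powr)
    finally show ?thesis .
  qed
  then show "eventually (\<lambda>e. tau e = integral {0..e} (\<lambda>s. P0bar lam kap U0 R0 s powr (2 * lam))) (at_left 1)"
    by (intro eventually_at_leftI[of 0]) auto
qed

lemma is_eta: "is_eta lam kap U0 R0 1 t_star eta"
  unfolding is_eta_def
proof (intro conjI ballI)
  show "strict_mono_on {0..<t_star} eta"
    using eta_less t_neg_neg by (auto simp: strict_mono_on_def)
  show "eta ` {0..<t_star} \<subseteq> {0..<1}" using eta_range by auto
  fix t assume t: "t \<in> {0..<t_star}"
  then have "P0bar lam kap U0 R0 (eta t) powr (- 2 * lam) = h (eta t)"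
    using eta_range[of t] by (intro P0bar_powr) auto
  moreover have "(eta has_real_derivative h (eta t)) (at t)"
    using t t_neg_neg by (intro eta_deriv) auto
  ultimately show "(eta has_real_derivative P0bar lam kap U0 R0 (eta t) powr (- 2 * lam))
      (at t within {0..<t_star})"
    by (simp only:) (rule has_field_derivative_at_within)
qed (rule eta_0)

lemma along_characteristics:
  assumes "t \<in> {0..<t_star}"
  shows "pdx u (gamma a t) t = W a (eta t)" "rho (gamma a t) t = R a (eta t)"
  using assms eta_range[of t] by (simp_all add: pdx_u rho_def gamma_def A_G)

lemma filterlim_along_characteristics:
  assumes "filterlim f K (at_left 1)" "\<And>t. t \<in> {0..<t_star} \<Longrightarrow> g t = f (eta t)"
  shows "filterlim g K (at_left t_star)"
proof -
  have "eventually (\<lambda>t. f (eta t) = g t) (at_left t_star)"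
    by (rule eventually_at_leftI[OF _ t_star_pos]) (simp add: assms(2))
  then show ?thesis
    using filterlim_compose[OF assms(1) eta_at_left] filterlim_cong[OF refl refl] by fast
qed

end

section \<open>Existence of data with one-point blow-up\<close>

theorem theorem4p60:
  fixes lam kap :: real
  assumes "lam > 0" and "kap > 0"
  shows "\<exists>(u0 :: real \<Rightarrow> real) (rho0 :: real \<Rightarrow> real) (eta_s :: real) (t_s :: real)
            (u :: real \<Rightarrow> real \<Rightarrow> real) (rho :: real \<Rightarrow> real \<Rightarrow> real)
            (\<gamma> :: real \<Rightarrow> real \<Rightarrow> real) (\<eta> :: real \<Rightarrow> real).
      admissible_data lam kap u0 rho0
    \<and> is_eta_star lam kap u0 rho0 eta_s
    \<and> is_larger_MN lam kap u0 rho0 (1 / eta_s)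
    \<and> finite (alpha_bar lam kap u0 rho0)
    \<and> {\<alpha>\<in>{0..1}. Q lam kap u0 rho0 \<alpha> eta_s = 0} = alpha_bar lam kap u0 rho0
    \<and> (\<forall>\<alpha>\<in>alpha_bar lam kap u0 rho0. order eta_s (Q_poly lam kap u0 rho0 \<alpha>) = 1)
    \<and> 0 < t_s \<and> is_t_star lam kap u0 rho0 eta_s t_s
    \<and> solves_ghs lam kap u0 rho0 t_s u rho
    \<and> characteristics t_s u \<gamma>
    \<and> is_eta lam kap u0 rho0 eta_s t_s \<eta>
    \<and> (\<forall>\<alpha>\<in>{0..1}. \<forall>t\<in>{0..<t_s}.
          pdx u (\<gamma> \<alpha> t) t = ux_formula lam kap u0 rho0 \<alpha> (\<eta> t) \<and>
          rho (\<gamma> \<alpha> t) t = rho_formula lam kap u0 rho0 \<alpha> (\<eta> t))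
    \<and> (\<forall>\<alpha>\<in>alpha_bar lam kap u0 rho0.
          filterlim (\<lambda>t. pdx u (\<gamma> \<alpha> t) t) at_top (at_left t_s) \<and>
          (rho0 \<alpha> > 0 \<longrightarrow> filterlim (\<lambda>t. rho (\<gamma> \<alpha> t) t) at_top (at_left t_s)) \<and>
          (rho0 \<alpha> < 0 \<longrightarrow> filterlim (\<lambda>t. rho (\<gamma> \<alpha> t) t) at_bot (at_left t_s)))
    \<and> (\<forall>\<alpha>\<in>{0..1} - alpha_bar lam kap u0 rho0.
          filterlim (\<lambda>t. pdx u (\<gamma> \<alpha> t) t) at_bot (at_left t_s) \<and>
          (rho0 \<alpha> \<noteq> 0 \<longrightarrow>
             (lam \<le> 1 \<longrightarrow> ((\<lambda>t. rho (\<gamma> \<alpha> t) t) \<longlongrightarrow> 0) (at_left t_s)) \<and>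
             (lam > 1 \<longrightarrow> (\<exists>l. l \<noteq> 0 \<and> ((\<lambda>t. rho (\<gamma> \<alpha> t) t) \<longlongrightarrow> l) (at_left t_s)))) \<and>
          (rho0 \<alpha> = 0 \<longrightarrow> (\<forall>t\<in>{0..<t_s}. rho (\<gamma> \<alpha> t) t = 0)))"
proof -
  interpret ghs_data lam kap using assms by unfold_locales
  have off_peak: "bump a < 1" if "a \<in> {0..1} - {1 / 2}" for a
    using that bump_eq_1_iff[of a] bump_bounds(2)[of a] by auto
  have formulas: "pdx u (gamma a t) t = ux_formula lam kap U0 R0 a (eta t) \<and>
      rho (gamma a t) t = rho_formula lam kap U0 R0 a (eta t)" if "t \<in> {0..<t_star}" for a t
    using that eta_range[of t] by (simp add: along_characteristics ux_formula_eq rho_formula_eq)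
  have peak: "filterlim (\<lambda>t. pdx u (gamma (1 / 2) t) t) at_top (at_left t_star)"
    "filterlim (\<lambda>t. rho (gamma (1 / 2) t) t) at_top (at_left t_star)"
    by (rule filterlim_along_characteristics[OF W_peak] filterlim_along_characteristics[OF R_peak],
        simp add: along_characteristics)+
  have away: "filterlim (\<lambda>t. pdx u (gamma a t) t) at_bot (at_left t_star)"
    "lam \<le> 1 \<longrightarrow> ((\<lambda>t. rho (gamma a t) t) \<longlongrightarrow> 0) (at_left t_star)"
    "lam > 1 \<longrightarrow> (\<exists>l. l \<noteq> 0 \<and> ((\<lambda>t. rho (gamma a t) t) \<longlongrightarrow> l) (at_left t_star))"
    if "a \<in> {0..1} - {1 / 2}" for a
  proof -
    note a = off_peak[OF that]
    show "filterlim (\<lambda>t. pdx u (gamma a t) t) at_bot (at_left t_star)"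
      by (rule filterlim_along_characteristics[OF W_off_peak[OF a]]) (simp add: along_characteristics)
    have lim: "((\<lambda>t. rho (gamma a t) t) \<longlongrightarrow> l) (at_left t_star)" if "(R a \<longlongrightarrow> l) (at_left 1)" for l
      by (rule filterlim_along_characteristics[OF that]) (simp add: along_characteristics)
    show "lam \<le> 1 \<longrightarrow> ((\<lambda>t. rho (gamma a t) t) \<longlongrightarrow> 0) (at_left t_star)"
    proof
      assume "lam \<le> 1"
      show "((\<lambda>t. rho (gamma a t) t) \<longlongrightarrow> 0) (at_left t_star)"
        by (intro lim R_off_peak_le_1 a \<open>lam \<le> 1\<close>)
    qed
    show "lam > 1 \<longrightarrow> (\<exists>l. l \<noteq> 0 \<and> ((\<lambda>t. rho (gamma a t) t) \<longlongrightarrow> l) (at_left t_star))"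
    proof
      assume "lam > 1"
      then obtain l where "l \<noteq> 0" "(R a \<longlongrightarrow> l) (at_left 1)" using R_off_peak_gt_1[OF a] by blast
      then show "\<exists>l. l \<noteq> 0 \<and> ((\<lambda>t. rho (gamma a t) t) \<longlongrightarrow> l) (at_left t_star)"
        using lim by blast
    qed
  qed
  have R0: "R0 a \<noteq> 0" "\<not> R0 a < 0" for a using R0_pos[of a] by auto
  show ?thesis
  proof (rule exI[of _ U0], rule exI[of _ R0], rule exI[of _ 1], rule exI[of _ t_star],
      rule exI[of _ u], rule exI[of _ rho], rule exI[of _ gamma], rule exI[of _ eta],
      unfold alpha_bar_eq, intro conjI)
    show "admissible_data lam kap U0 R0" by (rule data_admissible)
    show "is_eta_star lam kap U0 R0 1" by (rule eta_star_is_1)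
    show "is_larger_MN lam kap U0 R0 (1 / 1)" by (simp add: is_larger_MN_iff)
    show "finite {1 / 2 :: real}" by simp
    show "{\<alpha>\<in>{0..1}. Q lam kap U0 R0 \<alpha> 1 = 0} = {1 / 2}" by (rule Q_zero_set)
    show "\<forall>\<alpha>\<in>{1 / 2}. order 1 (Q_poly lam kap U0 R0 \<alpha>) = 1"
      using single_root by blast
    show "0 < t_star" by (rule t_star_pos)
    show "is_t_star lam kap U0 R0 1 t_star" by (rule is_t_star)
    show "solves_ghs lam kap U0 R0 t_star u rho" by (rule u_rho_solve)
    show "characteristics t_star u gamma" by (rule gamma_characteristics)
    show "is_eta lam kap U0 R0 1 t_star eta" by (rule is_eta)
  qed (use formulas peak away R0 in blast)+
qed

end
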